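(* Let $d\ge1$ and $p\in(1,2)$, $p'=\frac p{p-1}$. The discrete Fourier transform $f\mapsto(\widehat f(k))_{k\in\mathbb{Z}^d}$, $\widehat f(k)=\int_{\mathbb{T}^d}f(x)e^{-i\langle k,x\rangle}\,dx$, is a bounded linear operator from $L^p(\mathbb{T}^d)$ into the Lorentz sequence space $\ell^{p',p}(\mathbb{Z}^d)$, and it is not strictly singular.
   Context: $\mathbb{T}^d=[0,2\pi)^d$ with Lebesgue measure. $\ell^{p',p}(\mathbb{Z}^d)$ is the Lorentz space over $\mathbb{Z}^d$ with counting measure: sequences $a$ with $\|a\|=\big(\int_0^\infty(t^{1/p'}a^*(t))^p\frac{dt}t\big)^{1/p}<\infty$, $a^*$ the nonincreasing rearrangement. A bounded linear operator $T:X\to Y$ is strictly singular if there is no infinite-dimensional subspace $Z\subseteq X$ such that $T|_Z$ is an isomorphism onto $T(Z)$. *)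

theory Defs
  imports "HOL-Analysis.Analysis"
begin

definition torus :: "(real^'n) set" where
  "torus = {x. \<forall>i. 0 \<le> x$i \<and> x$i < 2*pi}"

definition Tmeas :: "(real^'n) measure" where
  "Tmeas = lebesgue_on torus"

definition in_Lp :: "real \<Rightarrow> (real^'n \<Rightarrow> complex) \<Rightarrow> bool" where
  "in_Lp p f \<longleftrightarrow> f \<in> borel_measurable Tmeas \<and> integrable Tmeas (\<lambda>x. norm (f x) powr p)"

definition Lp_norm :: "real \<Rightarrow> (real^'n \<Rightarrow> complex) \<Rightarrow> real" where
  "Lp_norm p f = (\<integral>x. norm (f x) powr p \<partial>Tmeas) powr (1/p)"

definition fourier :: "(real^'n \<Rightarrow> complex) \<Rightarrow> int^'n \<Rightarrow> complex" where
  "fourier f k = (\<integral>x. f x * cis (- (\<Sum>i\<in>UNIV. of_int (k$i) * x$i)) \<partial>Tmeas)"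

definition rearr :: "(int^'n \<Rightarrow> complex) \<Rightarrow> real \<Rightarrow> ennreal" where
  "rearr a t = Inf {s::ennreal. emeasure (count_space UNIV) {k. ennreal (norm (a k)) > s} \<le> ennreal t}"

definition lorentz_pow :: "real \<Rightarrow> (int^'n \<Rightarrow> complex) \<Rightarrow> ennreal" where
  "lorentz_pow p a = (\<integral>\<^sup>+ t \<in> {0<..}.
      (if rearr a t = top then top
       else ennreal ((t powr (1 / (p / (p - 1))) * enn2real (rearr a t)) powr p / t)) \<partial>lborel)"

definition in_lorentz :: "real \<Rightarrow> (int^'n \<Rightarrow> complex) \<Rightarrow> bool" where
  "in_lorentz p a \<longleftrightarrow> lorentz_pow p a < top"

definition lorentz_norm :: "real \<Rightarrow> (int^'n \<Rightarrow> complex) \<Rightarrow> real" where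
  "lorentz_norm p a = enn2real (lorentz_pow p a) powr (1/p)"

definition fun_subspace :: "('a \<Rightarrow> complex) set \<Rightarrow> bool" where
  "fun_subspace Z \<longleftrightarrow> (\<lambda>x. 0) \<in> Z \<and> (\<forall>f\<in>Z. \<forall>g\<in>Z. \<forall>c::complex. (\<lambda>x. c * f x + g x) \<in> Z)"

text \<open>Z is infinite-dimensional as a subspace of L^p, i.e. modulo functions vanishing a.e.:
  for every n there are n elements of Z linearly independent modulo a.e. equality.\<close>
definition inf_dim_ae :: "'a measure \<Rightarrow> ('a \<Rightarrow> complex) set \<Rightarrow> bool" where
  "inf_dim_ae M Z \<longleftrightarrow> (\<forall>n. \<exists>fs::nat \<Rightarrow> 'a \<Rightarrow> complex. (\<forall>i<n. fs i \<in> Z) \<and>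
     (\<forall>c::nat \<Rightarrow> complex. (AE x in M. (\<Sum>i<n. c i * fs i x) = 0) \<longrightarrow> (\<forall>i<n. c i = 0)))"

end

theory Submission
  imports Defs
begin

text \<open>Boundedness is Paley's inequality. With a the Fourier transform of f and a* its
  rearrangement, the p-th power of the Lorentz norm is the integral of (t a*(t))^p against the
  measure t^(-2) dt, and f |-> (t |-> t a*(t)) is of weak types (1,1) and (2,2) with respect to
  this measure, so Marcinkiewicz interpolation applies.

  For the failure of strict singularity take frequencies on one coordinate axis and let f_j be
  2^(-j/p') times the sum of the characters with frequencies in the dyadic block [2^j, 2^(j+1)),
  centred at pi. On the Fourier side the f_j have disjoint supports of size 2^j and modulus about
  2^(-j/p'), so a*(t) is at least c |c_j| 2^(-j/p') for t between 2^(j-1) and 2^j, which gives the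
  lower bound c (sum_j |c_j|^p)^(1/p) for the Lorentz norm of the transform of sum_j c_j f_j.
  Conversely |f_j| is at most 2^(-j/p') min(2^j, pi/|u|) with u the distance to the centre, and a
  Schur test shows that the L^p norm of sum_j c_j f_j is at most C (sum_j |c_j|^p)^(1/p).\<close>

subsection \<open>Fourier analysis on the torus\<close>

lemma torus_sets [measurable]: "(torus :: (real^'n) set) \<in> sets borel"
proof -
  have "(torus :: (real^'n) set) = (\<Inter>i\<in>UNIV. {x. 0 \<le> x$i} \<inter> {x. x$i < 2*pi})"
    by (auto simp: torus_def)
  also have "\<dots> \<in> sets borel"
    by (intro sets.countable_INT' sets.Int) (auto intro: closed_Collect_le open_Collect_less borel_closed borel_open continuous_intros)
  finally show ?thesis .
qed

lemma space_Tmeas [simp]: "space Tmeas = torus"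
  by (simp add: Tmeas_def)

lemma borel_imp_Tmeas [measurable_dest]: "f \<in> borel_measurable borel \<Longrightarrow> f \<in> borel_measurable Tmeas"
  unfolding Tmeas_def
  by (intro measurable_restrict_space1 measurable_completion) simp

lemma nn_integral_Tmeas:
  fixes f :: "real^'n \<Rightarrow> ennreal"
  shows "(\<integral>\<^sup>+x. f x \<partial>Tmeas) = (\<integral>\<^sup>+x. f x * indicator torus x \<partial>lborel)"
  unfolding Tmeas_def by (simp add: nn_integral_restrict_space nn_integral_completion)

lemma integral_Tmeas:
  fixes f :: "real^'n \<Rightarrow> complex"
  assumes "f \<in> borel_measurable borel"
  shows "(\<integral>x. f x \<partial>Tmeas) = (\<integral>x. indicator torus x *\<^sub>R f x \<partial>lborel)"
  unfolding Tmeas_def using assms by (simp add: integral_restrict_space integral_completion)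

text \<open>The torus is a box, so membership is decided coordinate by coordinate. This
  factorization is what lets the product forms of Tonelli and Fubini act on torus integrals.\<close>

lemma indicator_torus:
  "indicator torus x = (\<Prod>b\<in>Basis. indicator {0..<2*pi} (x \<bullet> b) :: 'a::{comm_semiring_1})" for x :: "real^'n"
proof (cases "x \<in> torus")
  case True
  then have "(\<Prod>b\<in>Basis. indicator {0..<2*pi} (x \<bullet> b)) = (1::'a)"
    by (intro prod.neutral) (auto simp: torus_def Basis_vec_def inner_axis)
  with True show ?thesis by simp
next
  case False
  then obtain i where "x$i \<notin> {0..<2*pi}" by (auto simp: torus_def)
  then have "\<exists>b\<in>Basis. indicator {0..<2*pi} (x \<bullet> b) = (0::'a)"
    by (intro bexI[of _ "axis i 1"]) (auto simp: Basis_vec_def inner_axis indicator_def)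
  with False show ?thesis by (simp add: prod_zero)
qed

lemma prod_Basis_vec:
  fixes h :: "real^'n \<Rightarrow> 'a::comm_monoid_mult"
  shows "(\<Prod>b\<in>Basis. h b) = (\<Prod>i\<in>UNIV. h (axis i 1))"
proof -
  have "inj (\<lambda>i::'n. axis i (1::real))" by (auto simp: inj_on_def axis_eq_axis)
  moreover have "(Basis :: (real^'n) set) = range (\<lambda>i. axis i 1)" by (auto simp: Basis_vec_def)
  ultimately show ?thesis by (metis (no_types, lifting) prod.reindex_cong)
qed

text \<open>Tonelli: every coordinate other than \<open>i0\<close> contributes a factor 2 pi. It
  reduces the L^p norms of the bump sums below to integrals over an interval.\<close>

lemma nn_integral_torus_coordinate:
  fixes i0 :: "'n::finite" and g :: "real \<Rightarrow> ennreal"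
  assumes [measurable]: "g \<in> borel_measurable borel"
  shows "(\<integral>\<^sup>+x. g (x$i0) \<partial>(Tmeas :: (real^'n) measure))
    = ennreal ((2*pi)^(CARD('n)-1)) * (\<integral>\<^sup>+y\<in>{0..<2*pi}. g y \<partial>lborel)"
proof -
  \<comment> \<open>The factor at \<open>i0\<close> carries \<open>g\<close>; all factors carry the
    interval indicator.\<close>
  define h where "h b y = (if b = axis i0 1 then g y else 1) * indicator {0..<2*pi} y" for b :: "real^'n" and y
  have [measurable]: "h b \<in> borel_measurable borel" for b unfolding h_def by simp
  have eq: "g (x$i0) * indicator torus x = (\<Prod>b\<in>Basis. h b (x \<bullet> b))" for x :: "real^'n"
    unfolding h_def prod.distrib indicator_torus
    by (subst prod.delta_remove) (auto simp: Basis_vec_def inner_axis)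
  have "(\<integral>\<^sup>+x. g (x$i0) \<partial>(Tmeas :: (real^'n) measure)) = (\<Prod>b\<in>Basis. \<integral>\<^sup>+y. h b y \<partial>lborel)"
    by (simp add: nn_integral_Tmeas eq nn_integral_lborel_prod)
  also have "\<dots> = (\<Prod>i\<in>UNIV. \<integral>\<^sup>+y. h (axis i 1) y \<partial>lborel)" by (rule prod_Basis_vec)
  also have "\<dots> = (\<integral>\<^sup>+y. h (axis i0 1) y \<partial>lborel) * (\<Prod>i\<in>UNIV - {i0}. \<integral>\<^sup>+y. h (axis i 1) y \<partial>lborel)"
    by (rule prod.remove) auto
  also have "(\<Prod>i\<in>UNIV - {i0}. \<integral>\<^sup>+y. h (axis i 1) y \<partial>lborel) = (\<Prod>i\<in>UNIV - {i0}. ennreal (2*pi))"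
    by (intro prod.cong refl) (simp add: h_def axis_eq_axis)
  also have "\<dots> = ennreal ((2*pi)^(CARD('n)-1))"
    by (simp add: prod_ennreal ennreal_power card_Diff_singleton)
  finally show ?thesis by (simp add: h_def mult.commute)
qed

lemma emeasure_Tmeas: "emeasure (Tmeas :: (real^'n) measure) torus = ennreal ((2*pi)^CARD('n))"
proof -
  have "emeasure (Tmeas :: (real^'n) measure) torus = (\<integral>\<^sup>+x. 1 \<partial>(Tmeas :: (real^'n) measure))"
    by (simp)
  also have "\<dots> = ennreal ((2*pi)^(CARD('n)-1)) * (\<integral>\<^sup>+y\<in>{0..<2*pi}. 1 \<partial>lborel)"
    by (rule nn_integral_torus_coordinate[of "\<lambda>_. 1"]) simp
  also have "\<dots> = ennreal ((2*pi)^(CARD('n)-1) * (2*pi))"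
    by (subst ennreal_mult) auto
  also have "(2*pi)^(CARD('n)-1) * (2*pi) = (2*pi)^CARD('n)"
    by (metis One_nat_def Suc_pred mult.commute power_Suc zero_less_card_finite)
  finally show ?thesis .
qed

lemma finite_measure_Tmeas: "finite_measure Tmeas"
  by (rule finite_measureI) (simp add: emeasure_Tmeas)

lemma measure_Tmeas: "measure (Tmeas :: (real^'n) measure) torus = (2*pi)^CARD('n)"
  by (simp add: measure_def emeasure_Tmeas)

section \<open>Characters and their orthogonality\<close>

definition torus_char :: "int^'n \<Rightarrow> real^'n \<Rightarrow> complex" where
  "torus_char k x = cis (\<Sum>i\<in>UNIV. of_int (k$i) * x$i)"

lemma norm_char [simp]: "norm (torus_char k x) = 1"
  by (simp add: torus_char_def)

lemma char_measurable [measurable]: "torus_char k \<in> borel_measurable borel"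
  unfolding torus_char_def
  by (intro borel_measurable_continuous_onI continuous_intros)

lemma char_measurable_Tmeas [measurable]: "torus_char k \<in> borel_measurable Tmeas"
  by (rule borel_imp_Tmeas) simp

lemma fourier_eq: "fourier f k = (\<integral>x. f x * cnj (torus_char k x) \<partial>Tmeas)"
  by (simp add: fourier_def torus_char_def cis_cnj)

lemma cnj_char: "cnj (torus_char k x) = torus_char (- k) x"
  by (simp add: torus_char_def cis_cnj sum_negf)

lemma char_mult_cnj: "torus_char k x * cnj (torus_char l x) = torus_char (k - l) x"
  by (simp add: torus_char_def cis_cnj cis_mult sum_subtractf[symmetric] left_diff_distrib)

lemma cis_integral_0:
  assumes "k \<noteq> (0::int)"
  shows "(\<integral>y. indicator {0..<2*pi} y *\<^sub>R cis (of_int k * y) \<partial>lborel) = 0"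
proof -
  have m [measurable]: "(\<lambda>y. cis (of_int k * y)) \<in> borel_measurable borel"
    by (intro borel_measurable_continuous_onI continuous_intros)
  \<comment> \<open>Adding the null end point 2 pi gives a closed interval, as the fundamental
    theorem requires. The antiderivative has period 2 pi, so its boundary values cancel.\<close>
  have "(\<integral>y. indicator {0..<2*pi} y *\<^sub>R cis (of_int k * y) \<partial>lborel)
     = (\<integral>y. indicator {0..2*pi} y *\<^sub>R cis (of_int k * y) \<partial>lborel)"
    by (rule integral_cong_AE)
       (use AE_lborel_singleton[of "2*pi"] in \<open>auto simp: indicator_def elim!: eventually_mono\<close>)
  also have "\<dots> = cis (of_int k * (2*pi)) / (\<i> * of_int k) - cis (of_int k * 0) / (\<i> * of_int k)"
  proof (rule integral_FTC_Icc)
    show "((\<lambda>y. cis (of_int k * y) / (\<i> * of_int k)) has_vector_derivative cis (of_int k * x)) (at x within {0..2*pi})" for x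
      using assms unfolding cis_conv_exp
      by (auto intro!: derivative_eq_intros has_vector_derivative_real_field simp: scaleR_conv_of_real algebra_simps)
  qed (auto intro!: continuous_intros)
  also have "cis (of_int k * (2*pi)) = 1"
    using cis_multiple_2pi[of "of_int k"] by (simp add: mult.commute mult.left_commute)
  finally show ?thesis by simp
qed

lemma integral_char:
  "(\<integral>x. torus_char k x \<partial>(Tmeas :: (real^'n) measure)) = (if k = 0 then (2*pi)^CARD('n) else 0)"
proof (cases "k = 0")
  case True
  then show ?thesis by (simp add: torus_char_def measure_Tmeas scaleR_conv_of_real)
next
  case False
  then obtain i where i: "k$i \<noteq> 0" by (auto simp: vec_eq_iff)
  \<comment> \<open>Transports the frequency from coordinate indices to basis vectors: for b =
    \<open>axis i 1\<close> exactly one summand survives, namely \<open>k$i\<close>.\<close>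
  define c where "c b = (\<Sum>i\<in>UNIV. if b = axis i 1 then k$i else 0)" for b :: "real^'n"
  define h where "h b y = indicator {0..<2*pi} y *\<^sub>R cis (of_int (c b) * y)"
    for b :: "real^'n" and y
  have h_axis: "h (axis i 1) y = indicator {0..<2*pi} y *\<^sub>R cis (of_int (k$i) * y)" for i y
    by (simp add: h_def c_def axis_eq_axis)
  have [measurable]: "h b \<in> borel_measurable borel" for b
    unfolding h_def by (intro borel_measurable_scaleR borel_measurable_continuous_onI[of "\<lambda>y. cis (_ * y)"] continuous_intros) auto
  have int: "integrable lborel (h b)" for b
    unfolding h_def
    by (rule integrableI_bounded_set_indicator[where B=1])
       (auto intro!: borel_measurable_continuous_onI continuous_intros)
  have prod_cis: "(\<Prod>i\<in>S. cis (g i)) = cis (sum g S)" if "finite S" for S :: "'n set" and g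
    using that by (induction S) (auto simp: cis_mult)
  have eq: "indicator torus x *\<^sub>R torus_char k x = (\<Prod>b\<in>Basis. h b (x \<bullet> b))" for x
    by (simp add: prod_Basis_vec h_axis inner_axis torus_char_def prod_cis[symmetric] indicator_torus
        scaleR_conv_of_real prod.distrib of_real_prod of_real_indicator)
  interpret product_sigma_finite "\<lambda>b::real^'n. lborel :: real measure" by standard
  have "(\<integral>x. torus_char k x \<partial>(Tmeas :: (real^'n) measure)) = (\<integral>x. (\<Prod>b\<in>Basis. h b (x \<bullet> b)) \<partial>lborel)"
    by (simp add: integral_Tmeas eq)
  also have "\<dots> = (\<integral>x. (\<Prod>b\<in>Basis. h b (x b)) \<partial>(\<Pi>\<^sub>M b\<in>Basis. lborel))"
    by (subst lborel_eq, subst integral_distr) auto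
  also have "\<dots> = (\<Prod>b\<in>Basis. \<integral>y. h b y \<partial>lborel)"
    by (rule product_integral_prod) (auto intro: int)
  also have "\<dots> = 0"
    unfolding prod_Basis_vec
  proof (rule prod_zero)
    \<comment> \<open>A single coordinate with nonzero frequency makes the whole product
      vanish.\<close>
    have "(\<integral>y. h (axis i 1) y \<partial>lborel) = 0"
      unfolding h_axis by (rule cis_integral_0[OF i])
    then show "\<exists>i\<in>UNIV. (\<integral>y. h (axis i 1) y \<partial>lborel) = 0" by blast
  qed simp
  finally show ?thesis using False by simp
qed

section \<open>Integrals of powers near zero and near infinity\<close>

lemma nn_integral_powr_from_0:
  assumes "-1 < a" "0 \<le> u"
  shows "(\<integral>\<^sup>+x\<in>{0<..<u}. ennreal (x powr a) \<partial>lborel) = ennreal (u powr (a+1) / (a+1))"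
proof -
  have "(\<integral>\<^sup>+x\<in>{0<..<u}. ennreal (x powr a) \<partial>lborel) = (\<integral>\<^sup>+x. indicator {0..u} x * ennreal (x powr a) \<partial>lborel)"
    by (rule nn_integral_cong_AE)
       (use AE_lborel_singleton[of u] AE_lborel_singleton[of 0] in \<open>eventually_elim, auto simp: indicator_def\<close>)
  also have "\<dots> = (\<integral>\<^sup>+x. ennreal (indicator {0..u} x * x powr a) \<partial>lborel)"
    by (intro nn_integral_cong) (auto simp: indicator_def)
  also have "\<dots> = ennreal (u powr (a+1) / (a+1))"
    by (rule nn_integral_has_integral_lebesgue) (use has_integral_powr_from_0[OF assms] in auto)
  finally show ?thesis .
qed

lemma nn_integral_powr_to_inf:
  assumes "a < -1" "0 < u"
  shows "(\<integral>\<^sup>+x\<in>{u..}. ennreal (x powr a) \<partial>lborel) = ennreal (u powr (a+1) / (-a-1))"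
proof -
  have "(\<integral>\<^sup>+x\<in>{u..}. ennreal (x powr a) \<partial>lborel) = (\<integral>\<^sup>+x. ennreal (indicator {u..} x * x powr a) \<partial>lborel)"
    by (intro nn_integral_cong) (auto simp: indicator_def)
  also have "\<dots> = ennreal (- (u powr (a+1) / (a+1)))"
    by (rule nn_integral_has_integral_lebesgue) (use has_integral_powr_to_inf[OF assms] in auto)
  also have "- (u powr (a+1) / (a+1)) = u powr (a+1) / (-a-1)"
    using assms by (simp add: field_simps)
  finally show ?thesis .
qed

section \<open>Integrability and elementary bounds for Fourier coefficients\<close>

lemma in_Lp_imp_integrable:
  assumes "1 \<le> p" "in_Lp p f"
  shows "integrable Tmeas f"
proof (rule Bochner_Integration.integrable_bound)
  interpret finite_measure "Tmeas :: (real^'a) measure" by (rule finite_measure_Tmeas)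
  show "integrable Tmeas (\<lambda>x. 1 + norm (f x) powr p)"
    using assms by (auto simp: in_Lp_def)
  show "f \<in> borel_measurable Tmeas" using assms by (simp add: in_Lp_def)
  \<comment> \<open>The measure is finite, so the constant 1 can absorb the values with |f| at most
    1; elsewhere |f| is at most |f|^p.\<close>
  have "norm (f x) \<le> norm (1 + norm (f x) powr p)" for x
  proof (cases "norm (f x) \<le> 1")
    case True
    then show ?thesis by (simp add: add_increasing2)
  next
    case False
    then have "norm (f x) powr 1 \<le> norm (f x) powr p" using assms by (intro powr_mono) auto
    with False show ?thesis by simp
  qed
  then show "AE x in Tmeas. norm (f x) \<le> norm (1 + norm (f x) powr p)" by simp
qed

lemma integrable_Tmeas_bounded:
  fixes g :: "real^'n \<Rightarrow> 'b::{banach, second_countable_topology}"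
  assumes "g \<in> borel_measurable Tmeas" "\<And>x. norm (g x) \<le> B"
  shows "integrable Tmeas g"
  using finite_measure.integrable_const_bound[OF finite_measure_Tmeas, of g B] assms by simp

lemma integrable_mult_cnj_char:
  assumes "integrable Tmeas f"
  shows "integrable Tmeas (\<lambda>x. f x * cnj (torus_char k x))"
  proof (rule Bochner_Integration.integrable_bound[OF assms])
  have [measurable]: "f \<in> borel_measurable Tmeas" using assms by auto
  show "(\<lambda>x. f x * cnj (torus_char k x)) \<in> borel_measurable Tmeas"
    unfolding cnj_char by measurable
qed (simp add: norm_mult)

lemma fourier_linear:
  assumes "integrable Tmeas f" "integrable Tmeas g"
  shows "fourier (\<lambda>x. c * f x + g x) k = c * fourier f k + fourier g k"
proof -
  have "fourier (\<lambda>x. c * f x + g x) k = (\<integral>x. c * (f x * cnj (torus_char k x)) + g x * cnj (torus_char k x) \<partial>Tmeas)"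
    unfolding fourier_eq by (intro Bochner_Integration.integral_cong) (auto simp: algebra_simps)
  also have "\<dots> = c * fourier f k + fourier g k"
    using assms by (simp add: fourier_eq integrable_mult_cnj_char)
  finally show ?thesis .
qed

lemma norm_fourier_le: "norm (fourier f k) \<le> (\<integral>x. norm (f x) \<partial>Tmeas)"
proof -
  have "norm (fourier f k) \<le> (\<integral>x. norm (f x * cnj (torus_char k x)) \<partial>Tmeas)"
    unfolding fourier_eq by (rule integral_norm_bound)
  then show ?thesis by (simp add: norm_mult)
qed

lemma integrable_char: "integrable Tmeas (torus_char k)"
  by (rule integrable_Tmeas_bounded[where B=1]) auto

section \<open>Trigonometric polynomials and Bessel's inequality\<close>

lemma fourier_trig_poly:
  fixes a :: "int^'n \<Rightarrow> complex"
  assumes "finite F"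
  shows "fourier (\<lambda>x. \<Sum>k\<in>F. a k * torus_char k x) l = (if l \<in> F then (2*pi)^CARD('n) * a l else 0)"
proof -
  have "fourier (\<lambda>x. \<Sum>k\<in>F. a k * torus_char k x) l = (\<integral>x. (\<Sum>k\<in>F. a k * torus_char (k - l) x) \<partial>Tmeas)"
    by (simp add: fourier_eq sum_distrib_right mult.assoc char_mult_cnj)
  also have "\<dots> = (\<Sum>k\<in>F. a k * (if k = l then (2*pi)^CARD('n) else 0))"
    by (subst Bochner_Integration.integral_sum)
       (auto simp: integrable_char integral_char intro!: sum.cong)
  also have "\<dots> = (if l \<in> F then (2*pi)^CARD('n) * a l else 0)"
    using assms by (simp add: if_distrib[of "\<lambda>z. _ * z"] if_distrib[of of_real] mult.commute cong: if_cong)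
  finally show ?thesis .
qed

lemma trig_poly_bound: "norm (\<Sum>k\<in>F. a k * torus_char k x) \<le> (\<Sum>k\<in>F. norm (a k))"
  by (rule order.trans[OF norm_sum]) (simp add: norm_mult)

text \<open>Writing |P|^2 as P times its conjugate and expanding only the conjugate turns the
  integral into a combination of Fourier coefficients of P, which orthogonality has already
  computed.\<close>

lemma trig_poly_L2:
  fixes a :: "int^'n \<Rightarrow> complex"
  assumes "finite F"
  shows "(\<integral>x. (norm (\<Sum>k\<in>F. a k * torus_char k x))\<^sup>2 \<partial>Tmeas) = (2*pi)^CARD('n) * (\<Sum>k\<in>F. (norm (a k))\<^sup>2)"
proof -
  define P where "P x = (\<Sum>k\<in>F. a k * torus_char k x)" for x
  have P_meas: "P \<in> borel_measurable borel" unfolding P_def by measurable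
  have P_int: "integrable Tmeas P"
    by (rule integrable_Tmeas_bounded[where B="\<Sum>k\<in>F. norm (a k)"])
       (use P_meas in \<open>auto simp: P_def trig_poly_bound intro: borel_imp_Tmeas\<close>)
  have "complex_of_real (\<integral>x. (norm (P x))\<^sup>2 \<partial>Tmeas) = (\<integral>x. P x * cnj (P x) \<partial>Tmeas)"
    by (subst integral_complex_of_real[symmetric]) (simp only: complex_norm_square)
  also have "\<dots> = (\<integral>x. (\<Sum>k\<in>F. cnj (a k) * (P x * cnj (torus_char k x))) \<partial>Tmeas)"
    by (intro Bochner_Integration.integral_cong refl, subst (2) P_def)
       (simp add: sum_distrib_left mult_ac)
  also have "\<dots> = (\<Sum>k\<in>F. cnj (a k) * fourier P k)"
    by (subst Bochner_Integration.integral_sum)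
       (auto simp: fourier_eq intro!: integrable_mult_cnj_char P_int)
  also have "\<dots> = (\<Sum>k\<in>F. cnj (a k) * ((2*pi)^CARD('n) * a k))"
    unfolding P_def using assms by (intro sum.cong refl) (simp add: fourier_trig_poly)
  also have "\<dots> = complex_of_real ((2*pi)^CARD('n) * (\<Sum>k\<in>F. (norm (a k))\<^sup>2))"
    by (simp add: sum_distrib_left complex_norm_square mult_ac del: of_real_power)
  finally show ?thesis unfolding of_real_eq_iff by (simp add: P_def)
qed

text \<open>Let P have the Fourier coefficients of g on F. The coefficient sum S equals the pairing
  of g with P, and the integral of |P|^2 is A S. Young's inequality bounds the pairing by half of A
  times the integral of |g|^2 plus half of S, and the latter is absorbed on the left.\<close>

lemma bessel_inequality:
  fixes g :: "real^'n \<Rightarrow> complex"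
  assumes [measurable]: "g \<in> borel_measurable Tmeas" and B: "\<And>x. norm (g x) \<le> B" and F: "finite F"
  shows "(\<Sum>k\<in>F. (norm (fourier g k))\<^sup>2) \<le> (2*pi)^CARD('n) * (\<integral>x. (norm (g x))\<^sup>2 \<partial>Tmeas)"
proof -
  define A where "A = (2*pi)^CARD('n)"
  have A: "A > 0" by (simp add: A_def)
  define a where "a = fourier g"
  define P where "P x = (\<Sum>k\<in>F. a k * torus_char k x)" for x
  define S where "S = (\<Sum>k\<in>F. (norm (a k))\<^sup>2)"
  have P_meas [measurable]: "P \<in> borel_measurable Tmeas"
    unfolding P_def by (intro borel_imp_Tmeas) measurable
  have g_int: "integrable Tmeas g" by (rule integrable_Tmeas_bounded[OF _ B]) simp
  have P2_int: "integrable Tmeas (\<lambda>x. (norm (P x))\<^sup>2)"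
    by (rule integrable_Tmeas_bounded[where B="(\<Sum>k\<in>F. norm (a k))\<^sup>2"])
       (auto simp: P_def trig_poly_bound intro!: power_mono)
  have g2_int: "integrable Tmeas (\<lambda>x. (norm (g x))\<^sup>2)"
    by (rule integrable_Tmeas_bounded[where B="B\<^sup>2"]) (auto simp: B intro!: power_mono)
  have "complex_of_real S = (\<Sum>k\<in>F. cnj (a k) * fourier g k)"
    by (simp add: S_def a_def complex_norm_square mult.commute del: of_real_power)
  also have "\<dots> = (\<integral>x. (\<Sum>k\<in>F. cnj (a k) * (g x * cnj (torus_char k x))) \<partial>Tmeas)"
    by (subst Bochner_Integration.integral_sum)
       (auto simp: fourier_eq intro!: integrable_mult_cnj_char g_int)
  also have "\<dots> = (\<integral>x. g x * cnj (P x) \<partial>Tmeas)"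
    by (intro Bochner_Integration.integral_cong refl) (simp add: P_def sum_distrib_left mult_ac)
  finally have "norm (complex_of_real S) \<le> (\<integral>x. norm (g x * cnj (P x)) \<partial>Tmeas)"
    by (metis integral_norm_bound)
  \<comment> \<open>The weights A and 1/A in Young's inequality are chosen so that the P term
    integrates to exactly S.\<close>
  also have "\<dots> \<le> (\<integral>x. (A * (norm (g x))\<^sup>2 + (norm (P x))\<^sup>2 / A) / 2 \<partial>Tmeas)"
  proof (rule integral_mono')
    show "norm (g x * cnj (P x)) \<le> (A * (norm (g x))\<^sup>2 + (norm (P x))\<^sup>2 / A) / 2" for x
    proof -
      have "0 \<le> (A * norm (g x) - norm (P x))\<^sup>2 / A" using A by simp
      also have "\<dots> = A * (norm (g x))\<^sup>2 + (norm (P x))\<^sup>2 / A - 2 * (norm (g x) * norm (P x))"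
        using A by (simp add: power2_diff field_simps power2_eq_square)
      finally show ?thesis by (simp add: norm_mult)
    qed
  qed (use P2_int g2_int A in auto)
  also have "\<dots> = (A * (\<integral>x. (norm (g x))\<^sup>2 \<partial>Tmeas) + S) / 2"
    using P2_int g2_int A trig_poly_L2[OF F, of a] by (simp add: S_def P_def A_def)
  finally have "S \<le> A * (\<integral>x. (norm (g x))\<^sup>2 \<partial>Tmeas)"
    by simp
  then show ?thesis by (simp add: S_def a_def A_def)
qed

subsection \<open>Paley's inequality\<close>

lemma finite_subset_of_large_measure:
  assumes "\<not> emeasure (count_space UNIV) X \<le> ennreal t" "0 \<le> t"
  obtains F where "finite F" "F \<subseteq> X" "t < real (card F)"
proof (cases "finite X")
  case True
  then show ?thesis using assms that[of X] by (simp add: ennreal_of_nat_eq_real_of_nat not_le)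
next
  case False
  obtain n where "t < real n" using reals_Archimedean2 by blast
  then show ?thesis using infinite_arbitrarily_large[OF False, of n] that by metis
qed

lemma rearr_antimono: "s \<le> t \<Longrightarrow> rearr a t \<le> rearr a s" for s t :: real
  unfolding rearr_def by (intro Inf_superset_mono) (auto intro: order.trans ennreal_leI)

lemma rearr_bounded:
  assumes "\<And>k. norm (a k) \<le> B"
  shows "rearr a t \<le> ennreal B"
proof -
  have "{k. ennreal (norm (a k)) > ennreal B} = {}" using assms by (auto simp: not_less intro: ennreal_leI)
  then show ?thesis unfolding rearr_def by (intro Inf_lower) auto
qed

text \<open>Monotone functions are Borel. The bound matters because \<open>enn2real\<close> sends
  infinity to 0 and so preserves order only between finite values.\<close>

lemma rearr_measurable:
  assumes "\<And>k. norm (a k) \<le> B"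
  shows "(\<lambda>t. enn2real (rearr a t)) \<in> borel_measurable borel"
proof -
  have "rearr a t < top" for t
    using rearr_bounded[OF assms, where t=t] by (rule le_less_trans) simp_all
  then have "mono (\<lambda>t. - enn2real (rearr a t))"
    by (auto intro!: monoI enn2real_mono rearr_antimono)
  then have "(\<lambda>t. - (- enn2real (rearr a t))) \<in> borel_measurable borel"
    by (intro borel_measurable_uminus borel_measurable_mono)
  then show ?thesis by simp
qed

text \<open>The exponent 1/p' times p is p - 1, and division by t leaves t^(p-2). Finiteness of the
  rearrangement excludes the \<open>top\<close> branch of the definition.\<close>

lemma lorentz_pow_eq:
  assumes p: "1 < p" and fin: "\<And>t. rearr a t < top"
  shows "lorentz_pow p a = (\<integral>\<^sup>+t\<in>{0<..}. ennreal (t powr (p - 2) * enn2real (rearr a t) powr p) \<partial>lborel)"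
proof -
  have *: "(t powr (1 / (p / (p - 1))) * r) powr p / t = t powr (p - 2) * r powr p" if "t > 0" "r \<ge> 0" for t r
  proof -
    have e: "1 / (p / (p - 1)) * p = p - 1" using p by (simp add: field_simps)
    have "(t powr (1 / (p / (p - 1))) * r) powr p / t = t powr (p - 1) * r powr p * t powr (- 1)"
      unfolding powr_mult powr_powr e using that by (simp add: powr_minus divide_inverse)
    also have "\<dots> = (t powr (p - 1) * t powr (-1)) * r powr p" by (simp only: mult_ac)
    also have "t powr (p - 1) * t powr (-1) = t powr (p - 2)" by (subst powr_add[symmetric]) simp
    finally show ?thesis .
  qed
  have "rearr a t \<noteq> top" for t using fin[of t] by auto
  then show ?thesis unfolding lorentz_pow_def
    by (intro nn_integral_cong) (use * in \<open>auto simp: indicator_def\<close>)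
qed

section \<open>Weak-type estimates and interpolation\<close>

text \<open>Marcinkiewicz splitting: the part of f above height l is estimated by the trivial
  sup-norm bound on its Fourier transform, the part below by Bessel's inequality.\<close>

lemma level_set_bound:
  fixes f :: "real^'n \<Rightarrow> complex"
  assumes f: "integrable Tmeas f" and l: "0 < l" and t: "0 < t"
    and less: "l < t * enn2real (rearr (fourier f) t)"
  shows "ennreal (1 / t) \<le> (\<integral>\<^sup>+x. ennreal (if l < norm (f x) then 2 * norm (f x) / l
            else 4 * (2*pi)^CARD('n) * (norm (f x))\<^sup>2 / l\<^sup>2) \<partial>Tmeas)"
proof -
  define A where "A = (2*pi)^CARD('n)"
  have A: "A > 0" by (simp add: A_def)
  have [measurable]: "f \<in> borel_measurable Tmeas" using f by auto
  define f1 where "f1 x = (if l < norm (f x) then f x else 0)" for x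
  define f2 where "f2 x = (if l < norm (f x) then 0 else f x)" for x
  have [measurable]: "f1 \<in> borel_measurable Tmeas" "f2 \<in> borel_measurable Tmeas"
    unfolding f1_def f2_def by measurable
  have f1_int: "integrable Tmeas f1"
    by (rule Bochner_Integration.integrable_bound[OF f]) (auto simp: f1_def)
  have f2_bd: "norm (f2 x) \<le> l" for x using l by (auto simp: f2_def)
  have f2_int: "integrable Tmeas f2" by (rule integrable_Tmeas_bounded[OF _ f2_bd]) simp
  have f22_int: "integrable Tmeas (\<lambda>x. (norm (f2 x))\<^sup>2)"
    by (rule integrable_Tmeas_bounded[where B="l\<^sup>2"]) (auto intro!: power_mono f2_bd)
  define I1 where "I1 = (\<integral>x. norm (f1 x) \<partial>Tmeas)"
  define I2 where "I2 = (\<integral>x. (norm (f2 x))\<^sup>2 \<partial>Tmeas)"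
  have I_nonneg: "I1 \<ge> 0" "I2 \<ge> 0" by (simp_all add: I1_def I2_def)
  have fourier_f: "fourier f k = fourier f1 k + fourier f2 k" for k
  proof -
    have "f = (\<lambda>x. 1 * f1 x + f2 x)" by (auto simp: f1_def f2_def)
    then show ?thesis using fourier_linear[OF f1_int f2_int, of 1 k] by simp
  qed
  have "l / t < enn2real (rearr (fourier f) t)" using less t by (simp add: field_simps)
  then have rearr_gt: "ennreal (l / t) < rearr (fourier f) t"
    using l t by (cases "rearr (fourier f) t") (auto simp: ennreal_less_iff)
  \<comment> \<open>The level l/t lies strictly below the infimum defining the rearrangement, so it
    is not admissible: more than t coefficients exceed it in modulus.\<close>
  have "rearr (fourier f) t \<le> ennreal (l / t)"
    if "emeasure (count_space UNIV) {k. ennreal (norm (fourier f k)) > ennreal (l / t)} \<le> ennreal t"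
    unfolding rearr_def using that by (intro Inf_lower CollectI)
  with rearr_gt have "\<not> emeasure (count_space UNIV) {k. ennreal (norm (fourier f k)) > ennreal (l / t)} \<le> ennreal t"
    by (auto simp: not_le[symmetric])
  then obtain F where F: "finite F" "F \<subseteq> {k. ennreal (norm (fourier f k)) > ennreal (l / t)}" "t < real (card F)"
    using finite_subset_of_large_measure[of _ t] t by (metis less_imp_le)
  have F_gt: "norm (fourier f k) > l / t" if "k \<in> F" for k
    using F(2) that l t by (auto simp: ennreal_less_iff)
  \<comment> \<open>If the L^1 norm of \<open>f1\<close> exceeds l/(2t), the first term suffices.
    Otherwise \<open>f1\<close> accounts for at most half of the size l/t at each frequency in F, so
    \<open>f2\<close> has coefficients of modulus at least l/(2t) at more than t frequencies, and
    Bessel makes the second term large enough.\<close>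
  have "1 / t \<le> 2 / l * I1 + 4 * A / l\<^sup>2 * I2"
  proof (cases "I1 > l / (2 * t)")
    case True
    then have "1 / t \<le> 2 / l * I1" using l t by (simp add: field_simps)
    also have "\<dots> \<le> 2 / l * I1 + 4 * A / l\<^sup>2 * I2" using A I_nonneg by simp
    finally show ?thesis .
  next
    case False
    have "l / (2 * t) \<le> norm (fourier f2 k)" if "k \<in> F" for k
    proof -
      have "l / t < norm (fourier f1 k) + norm (fourier f2 k)"
        using F_gt[OF that] norm_triangle_ineq[of "fourier f1 k" "fourier f2 k"] by (simp add: fourier_f)
      moreover have "norm (fourier f1 k) \<le> l / (2 * t)"
        using norm_fourier_le[of f1 k] False by (simp add: I1_def)
      ultimately show ?thesis by simp
    qed
    then have "(\<Sum>k\<in>F. (l / (2 * t))\<^sup>2) \<le> (\<Sum>k\<in>F. (norm (fourier f2 k))\<^sup>2)"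
      using l t by (intro sum_mono power_mono) auto
    also have "\<dots> \<le> A * I2"
      unfolding A_def I2_def by (rule bessel_inequality[OF _ f2_bd F(1)]) simp
    finally have "card F * (l / (2 * t))\<^sup>2 \<le> A * I2" by simp
    moreover have "t * (l / (2 * t))\<^sup>2 \<le> card F * (l / (2 * t))\<^sup>2"
      using F(3) by (intro mult_right_mono) auto
    ultimately have "t * (l / (2 * t))\<^sup>2 \<le> A * I2" by linarith
    then have "1 / t \<le> 4 * A / l\<^sup>2 * I2"
      using l t by (simp add: field_simps power2_eq_square)
    also have "\<dots> \<le> 2 / l * I1 + 4 * A / l\<^sup>2 * I2" using l I_nonneg by simp
    finally show ?thesis .
  qed
  also have "\<dots> = (\<integral>x. 2 / l * norm (f1 x) + 4 * A / l\<^sup>2 * (norm (f2 x))\<^sup>2 \<partial>Tmeas)"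
    using f1_int f22_int by (simp add: I1_def I2_def)
  finally have "ennreal (1 / t) \<le> ennreal (\<integral>x. 2 / l * norm (f1 x) + 4 * A / l\<^sup>2 * (norm (f2 x))\<^sup>2 \<partial>Tmeas)"
    by (rule ennreal_leI)
  also have "\<dots> = (\<integral>\<^sup>+x. ennreal (2 / l * norm (f1 x) + 4 * A / l\<^sup>2 * (norm (f2 x))\<^sup>2) \<partial>Tmeas)"
    using f1_int f22_int A l by (intro nn_integral_eq_integral[symmetric]) auto
  also have "\<dots> = (\<integral>\<^sup>+x. ennreal (if l < norm (f x) then 2 * norm (f x) / l
            else 4 * A * (norm (f x))\<^sup>2 / l\<^sup>2) \<partial>Tmeas)"
    by (intro nn_integral_cong) (auto simp: f1_def f2_def)
  finally show ?thesis unfolding A_def .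
qed

text \<open>For finite positive K the hypothesis confines T to the ray from 1/K on, whose mass under
  t^(-2) dt is exactly K. So a lower bound valid at each point of a level set becomes an upper bound
  for its measure.\<close>

lemma nn_integral_inverse_square_le:
  assumes "\<And>t. t \<in> T \<Longrightarrow> 0 < t \<and> ennreal (1 / t) \<le> K"
  shows "(\<integral>\<^sup>+t\<in>T. ennreal (t powr (-2)) \<partial>lborel) \<le> K"
proof (cases K)
  case (real k)
  show ?thesis
  proof (cases "k = 0")
    case True
    have "T = {}"
    proof (rule ccontr)
      assume "T \<noteq> {}"
      then obtain t where "0 < t" "ennreal (1 / t) \<le> K" using assms by blast
      then show False using True real by (simp add: ennreal_neg)
    qed
    then show ?thesis by simp
  next
    case False
    with real have k: "k > 0" by simp
    have "T \<subseteq> {1/k..}"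
    proof
      fix t assume "t \<in> T"
      then have "0 < t" "1 / t \<le> k" using assms[of t] real by (auto simp: ennreal_le_iff)
      then show "t \<in> {1/k..}" using k by (simp add: field_simps)
    qed
    then have "(\<integral>\<^sup>+t\<in>T. ennreal (t powr (-2)) \<partial>lborel) \<le> (\<integral>\<^sup>+t\<in>{1/k..}. ennreal (t powr (-2)) \<partial>lborel)"
      by (intro nn_integral_mono) (auto simp: indicator_def)
    also have "\<dots> = ennreal k"
      using k by (subst nn_integral_powr_to_inf) (simp_all add: powr_minus powr_divide divide_simps)
    finally show ?thesis using real by simp
  qed
qed auto

text \<open>Marcinkiewicz interpolation by a layer-cake argument: (t r(t))^p is an integral over
  heights l, the order of integration is exchanged, and for each l the function f is split at that
  same height. The remaining l-integral converges at 0 because p > 1 and at infinity because p < 2,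
  which also explains the denominators of the constant.\<close>

lemma paley_inequality:
  fixes f :: "real^'n \<Rightarrow> complex"
  assumes p: "1 < p" "p < 2" and f: "in_Lp p f"
  shows "lorentz_pow p (fourier f) \<le>
    ennreal (2 * p / (p - 1) + 4 * (2*pi)^CARD('n) * p / (2 - p)) * ennreal (\<integral>x. norm (f x) powr p \<partial>Tmeas)"
proof -
  define A where "A = (2*pi)^CARD('n)"
  have A: "A > 0" by (simp add: A_def)
  have f_int: "integrable Tmeas f" using in_Lp_imp_integrable[OF _ f] p by simp
  then have [measurable]: "f \<in> borel_measurable Tmeas" by auto
  define r where "r t = enn2real (rearr (fourier f) t)" for t
  have [measurable]: "r \<in> borel_measurable borel"
    unfolding r_def by (rule rearr_measurable[OF norm_fourier_le])
  have fin: "rearr (fourier f) t < top" for t :: real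
    using rearr_bounded[OF norm_fourier_le, where t=t] by (rule le_less_trans) simp_all
  \<comment> \<open>The integrand of \<open>level_set_bound\<close>: the upper branch comes from
    L^1, the lower one from L^2.\<close>
  define k where "k l x = (if l < norm (f x) then 2 * norm (f x) / l else 4 * A * (norm (f x))\<^sup>2 / l\<^sup>2)" for l x
  have [measurable]: "(\<lambda>(l, x). k l x) \<in> borel_measurable (lborel \<Otimes>\<^sub>M Tmeas)"
    unfolding k_def by measurable
  interpret T: finite_measure "Tmeas :: (real^'n) measure" by (rule finite_measure_Tmeas)
  interpret PT: pair_sigma_finite "lborel :: real measure" "Tmeas :: (real^'n) measure" ..
  \<comment> \<open>The layer-cake density: integrating it over l returns t^(-2) (t r(t))^p.\<close>
  define h where "h t l = (if 0 < t \<and> 0 < l \<and> l < t * r t then ennreal (p * l powr (p - 1)) * ennreal (t powr (-2)) else 0)" for t l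
  have [measurable]: "(\<lambda>(t, l). h t l) \<in> borel_measurable (lborel \<Otimes>\<^sub>M lborel)"
    unfolding h_def by measurable
  have "lorentz_pow p (fourier f) = (\<integral>\<^sup>+t\<in>{0<..}. ennreal (t powr (p - 2) * enn2real (rearr (fourier f) t) powr p) \<partial>lborel)"
    by (rule lorentz_pow_eq[OF p(1) fin])
  also have "\<dots> = (\<integral>\<^sup>+t. (\<integral>\<^sup>+l. h t l \<partial>lborel) \<partial>lborel)"
  proof (rule nn_integral_cong)
    fix t :: real
    show "ennreal (t powr (p - 2) * enn2real (rearr (fourier f) t) powr p) * indicator {0<..} t = (\<integral>\<^sup>+l. h t l \<partial>lborel)"
    proof (cases "t > 0")
      case True
      have r: "r t \<ge> 0" by (simp add: r_def)
      have "(\<integral>\<^sup>+l. h t l \<partial>lborel) = (\<integral>\<^sup>+l. ennreal (p * t powr (-2)) * (ennreal (l powr (p - 1)) * indicator {0<..<t * r t} l) \<partial>lborel)"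
        using p True by (intro nn_integral_cong) (auto simp: h_def indicator_def simp flip: ennreal_mult intro!: arg_cong[of _ _ ennreal])
      also have "\<dots> = ennreal (p * t powr (-2)) * (\<integral>\<^sup>+l\<in>{0<..<t * r t}. ennreal (l powr (p - 1)) \<partial>lborel)"
        by (rule nn_integral_cmult) simp
      also have "\<dots> = ennreal (p * t powr (-2) * ((t * r t) powr p / p))"
        using p True r by (subst nn_integral_powr_from_0) (auto simp flip: ennreal_mult)
      also have "p * t powr (-2) * ((t * r t) powr p / p) = t powr (p - 2) * r t powr p"
      proof -
        have "t powr (-2) * t powr p = t powr (p - 2)" by (subst powr_add[symmetric]) simp
        then show ?thesis using p True r by (simp add: powr_mult)
      qed
      finally show ?thesis using True by (simp add: r_def)
    qed (simp add: h_def)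
  qed
  also have "\<dots> = (\<integral>\<^sup>+l. (\<integral>\<^sup>+t. h t l \<partial>lborel) \<partial>lborel)"
    by (rule lborel_pair.Fubini') measurable
  also have "\<dots> \<le> (\<integral>\<^sup>+l. (\<integral>\<^sup>+x. (if 0 < l then ennreal (p * l powr (p - 1) * k l x) else 0) \<partial>Tmeas) \<partial>lborel)"
  proof (rule nn_integral_mono)
    fix l :: real
    show "(\<integral>\<^sup>+t. h t l \<partial>lborel) \<le> (\<integral>\<^sup>+x. (if 0 < l then ennreal (p * l powr (p - 1) * k l x) else 0) \<partial>Tmeas)"
    proof (cases "l > 0")
      case True
      have k_nonneg: "k l x \<ge> 0" for x using A True by (simp add: k_def)
      have [measurable]: "k l \<in> borel_measurable Tmeas" unfolding k_def by measurable
      \<comment> \<open>At each t in T, \<open>level_set_bound\<close> gives that 1/t is at most the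
        integral of \<open>k l\<close>, which is what the measure bound for t^(-2) dt needs.\<close>
      define T where "T = {t. 0 < t \<and> l < t * r t}"
      have [measurable]: "T \<in> sets borel" unfolding T_def by measurable
      have "(\<integral>\<^sup>+t. h t l \<partial>lborel) = (\<integral>\<^sup>+t. ennreal (p * l powr (p - 1)) * (ennreal (t powr (-2)) * indicator T t) \<partial>lborel)"
        using True by (intro nn_integral_cong) (auto simp: h_def T_def)
      also have "\<dots> = ennreal (p * l powr (p - 1)) * (\<integral>\<^sup>+t\<in>T. ennreal (t powr (-2)) \<partial>lborel)"
        by (rule nn_integral_cmult) simp
      also have "\<dots> \<le> ennreal (p * l powr (p - 1)) * (\<integral>\<^sup>+x. ennreal (k l x) \<partial>Tmeas)"
        by (intro mult_left_mono nn_integral_inverse_square_le)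
           (use level_set_bound[OF f_int True] in \<open>auto simp only: T_def r_def k_def A_def mem_Collect_eq zero_le\<close>)
      also have "\<dots> = (\<integral>\<^sup>+x. ennreal (p * l powr (p - 1)) * ennreal (k l x) \<partial>Tmeas)"
        by (rule nn_integral_cmult[symmetric]) simp
      also have "\<dots> = (\<integral>\<^sup>+x. (if 0 < l then ennreal (p * l powr (p - 1) * k l x) else 0) \<partial>Tmeas)"
        using True p k_nonneg by (intro nn_integral_cong) (simp add: ennreal_mult)
      finally show ?thesis .
    qed (simp add: h_def)
  qed
  also have "\<dots> = (\<integral>\<^sup>+x. (\<integral>\<^sup>+l. (if 0 < l then ennreal (p * l powr (p - 1) * k l x) else 0) \<partial>lborel) \<partial>Tmeas)"
    by (rule PT.Fubini'[symmetric]) measurable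
  also have "\<dots> = (\<integral>\<^sup>+x. ennreal ((2 * p / (p - 1) + 4 * A * p / (2 - p)) * norm (f x) powr p) \<partial>Tmeas)"
  proof (rule nn_integral_cong)
    fix x
    define u where "u = norm (f x)"
    show "(\<integral>\<^sup>+l. (if 0 < l then ennreal (p * l powr (p - 1) * k l x) else 0) \<partial>lborel)
       = ennreal ((2 * p / (p - 1) + 4 * A * p / (2 - p)) * norm (f x) powr p)"
    proof (cases "u = 0")
      case True
      then show ?thesis by (simp add: u_def k_def cong: if_cong)
    next
      case False
      then have u: "u > 0" by (simp add: u_def)
      \<comment> \<open>For fixed x the two branches of \<open>k\<close> meet at l = u: heights
        below u use the L^1 term, heights from u on the L^2 term.\<close>
      have "(\<integral>\<^sup>+l. (if 0 < l then ennreal (p * l powr (p - 1) * k l x) else 0) \<partial>lborel)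
        = (\<integral>\<^sup>+l. ennreal (2 * p * u) * (ennreal (l powr (p - 2)) * indicator {0<..<u} l)
             + ennreal (4 * A * p * u\<^sup>2) * (ennreal (l powr (p - 3)) * indicator {u..} l) \<partial>lborel)"
      proof (rule nn_integral_cong)
        fix l :: real
        have 1: "l powr (p - 1) / l = l powr (p - 2)" if "l > 0"
          using that powr_add[of l "p - 2" 1] by simp
        have 2: "l powr (p - 1) / l\<^sup>2 = l powr (p - 3)" if "l > 0"
          using that powr_add[of l "p - 3" 2] by simp
        show "(if 0 < l then ennreal (p * l powr (p - 1) * k l x) else 0)
          = ennreal (2 * p * u) * (ennreal (l powr (p - 2)) * indicator {0<..<u} l)
             + ennreal (4 * A * p * u\<^sup>2) * (ennreal (l powr (p - 3)) * indicator {u..} l)"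
          using p u A by (auto simp: k_def u_def[symmetric] indicator_def 1[symmetric] 2[symmetric] field_simps
              simp flip: ennreal_mult)
      qed
      also have "\<dots> = ennreal (2 * p * u) * (\<integral>\<^sup>+l\<in>{0<..<u}. ennreal (l powr (p - 2)) \<partial>lborel)
          + ennreal (4 * A * p * u\<^sup>2) * (\<integral>\<^sup>+l\<in>{u..}. ennreal (l powr (p - 3)) \<partial>lborel)"
        by (simp add: nn_integral_add nn_integral_cmult)
      also have "\<dots> = ennreal (2 * p * u * (u powr (p - 1) / (p - 1)) + 4 * A * p * u\<^sup>2 * (u powr (p - 2) / (2 - p)))"
        using p u A by (subst nn_integral_powr_from_0, simp, simp, subst nn_integral_powr_to_inf)
           (auto simp flip: ennreal_mult ennreal_plus)
      also have "2 * p * u * (u powr (p - 1) / (p - 1)) + 4 * A * p * u\<^sup>2 * (u powr (p - 2) / (2 - p))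
          = (2 * p / (p - 1) + 4 * A * p / (2 - p)) * u powr p"
      proof -
        have e: "u * u powr (p - 1) = u powr p" "u\<^sup>2 * u powr (p - 2) = u powr p"
          using u powr_add[of u 1 "p - 1"] powr_add[of u 2 "p - 2"] by simp_all
        have "(2 * p / (p - 1) + 4 * A * p / (2 - p)) * u powr p
          = 2 * p / (p - 1) * (u * u powr (p - 1)) + 4 * A * p / (2 - p) * (u\<^sup>2 * u powr (p - 2))"
          unfolding e by (rule distrib_right)
        then show ?thesis by (simp only: times_divide_eq_left times_divide_eq_right mult_ac)
      qed
      finally show ?thesis by (simp add: u_def)
    qed
  qed
  also have "\<dots> = ennreal (\<integral>x. (2 * p / (p - 1) + 4 * A * p / (2 - p)) * norm (f x) powr p \<partial>Tmeas)"
    using f p A by (intro nn_integral_eq_integral) (auto simp: in_Lp_def)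
  also have "\<dots> = ennreal (2 * p / (p - 1) + 4 * A * p / (2 - p)) * ennreal (\<integral>x. norm (f x) powr p \<partial>Tmeas)"
    using p A by (simp add: ennreal_mult)
  finally show ?thesis by (simp add: A_def)
qed

subsection \<open>Dyadic blocks of frequencies\<close>

lemma rearr_ge:
  assumes "finite F" "\<And>k. k \<in> F \<Longrightarrow> v \<le> norm (a k)" "0 \<le> t" "t < real (card F)"
  shows "ennreal v \<le> rearr a t"
  unfolding rearr_def
proof (rule Inf_greatest, clarify)
  fix s :: ennreal
  assume s: "emeasure (count_space UNIV) {k. s < ennreal (norm (a k))} \<le> ennreal t"
  show "ennreal v \<le> s"
  proof (rule ccontr)
    assume "\<not> ennreal v \<le> s"
    \<comment> \<open>A level below v has all of F in its superlevel set, hence more than t points,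
      and cannot be admissible.\<close>
    then have "F \<subseteq> {k. s < ennreal (norm (a k))}"
      using assms(2) by (auto simp: not_le intro: less_le_trans ennreal_leI)
    then have "emeasure (count_space UNIV) F \<le> emeasure (count_space UNIV) {k. s < ennreal (norm (a k))}"
      by (intro emeasure_mono) auto
    with s have "emeasure (count_space UNIV) F \<le> ennreal t" by (rule order.trans[rotated])
    moreover have "emeasure (count_space UNIV) F = ennreal (real (card F))"
      using assms(1) by (simp add: ennreal_of_nat_eq_real_of_nat)
    ultimately show False using assms by (simp add: ennreal_le_iff)
  qed
qed

text \<open>The dyadic intervals are pairwise disjoint, so at most one summand is nonzero at a given
  t. This allows block-by-block bounds to be compared with a single integrand.\<close>

lemma disjoint_dyadic_sum_le:
  fixes g :: "nat \<Rightarrow> ennreal"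
  assumes "\<And>j. j < n \<Longrightarrow> t \<in> {2^j/2<..<2^j} \<Longrightarrow> g j \<le> G"
  shows "(\<Sum>j<n. g j * indicator {2^j/2<..<2^j} (t::real)) \<le> G"
proof (cases "\<exists>j<n. t \<in> {2^j/2<..<2^j}")
  case True
  then obtain j where j: "j < n" "t \<in> {2^j/2<..<2^j}" by blast
  have uniq: "i = j" if "t \<in> {2^i/2<..<2^i}" for i
  proof -
    have "(2::real)^i < 2^Suc j" "(2::real)^j < 2^Suc i" using that j by auto
    then have "i < Suc j" "j < Suc i" by (meson one_less_numeral_iff power_less_imp_less_exp semiring_norm(76))+
    then show ?thesis by simp
  qed
  have "g i * indicator {2^i/2<..<2^i} t = (if i = j then g j else 0)" for i
    using uniq[of i] j(2) by (cases "i = j") (auto simp: indicator_def)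
  then have "(\<Sum>i<n. g i * indicator {2^i/2<..<2^i} t) = (\<Sum>i<n. if i = j then g j else 0)"
    by simp
  also have "\<dots> = g j" using j by simp
  finally show ?thesis using assms j by simp
next
  case False
  then have "(\<Sum>j<n. g j * indicator {2^j/2<..<2^j} t) = 0"
    by (intro sum.neutral) (auto simp: indicator_def)
  then show ?thesis by simp
qed

text \<open>Only the integral over the disjoint intervals (2^(j-1), 2^j) is kept; there t^(p-2) is at
  least 2^(j(p-2)) because p < 2.\<close>

lemma lorentz_pow_ge_dyadic:
  assumes p: "1 < p" "p < 2" and fin: "\<And>t. rearr a t < top"
    and F: "\<And>j. j < n \<Longrightarrow> finite (F j)" "\<And>j. j < n \<Longrightarrow> card (F j) = 2^j"
    and v: "\<And>j. 0 \<le> v j" "\<And>j k. j < n \<Longrightarrow> k \<in> F j \<Longrightarrow> v j \<le> norm (a k)"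
  shows "ennreal (\<Sum>j<n. v j powr p * 2 powr (real j * (p - 1)) / 2) \<le> lorentz_pow p a"
proof -
  \<comment> \<open>The minimum of the weight times the interval length 2^j/2 produces the factor
    2^(j(p-1))/2 of the statement.\<close>
  have *: "2 powr (real j * (p - 2)) * 2^j = 2 powr (real j * (p - 1))" for j :: nat
    by (simp add: algebra_simps flip: powr_realpow powr_add)
  have "ennreal (\<Sum>j<n. v j powr p * 2 powr (real j * (p - 1)) / 2)
      = (\<Sum>j<n. ennreal (2 powr (real j * (p - 2)) * v j powr p) * ennreal (2^j / 2))"
    by (subst sum_ennreal[symmetric]) (auto simp: *[symmetric] mult_ac simp flip: ennreal_mult)
  also have "\<dots> = (\<Sum>j<n. \<integral>\<^sup>+t. ennreal (2 powr (real j * (p - 2)) * v j powr p) * indicator {2^j/2<..<2^j::real} t \<partial>lborel)"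
    by (intro sum.cong refl) (simp add: nn_integral_cmult)
  also have "\<dots> = (\<integral>\<^sup>+t. (\<Sum>j<n. ennreal (2 powr (real j * (p - 2)) * v j powr p) * indicator {2^j/2<..<2^j::real} t) \<partial>lborel)"
    by (rule nn_integral_sum[symmetric]) simp
  also have "\<dots> \<le> (\<integral>\<^sup>+t\<in>{0<..}. ennreal (t powr (p - 2) * enn2real (rearr a t) powr p) \<partial>lborel)"
  proof (intro nn_integral_mono disjoint_dyadic_sum_le)
    fix t :: real and j assume j: "j < n" and t: "t \<in> {2^j/2<..<2^j::real}"
    have "0 < (2::real)^j / 2" by simp
    with t have t0: "t > 0" by (meson greaterThanLessThan_iff less_trans)
    \<comment> \<open>On this interval t is strictly below 2^j, the number of points of
      \<open>F j\<close>.\<close>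
    have "ennreal (v j) \<le> rearr a t"
      by (rule rearr_ge[OF F(1)[OF j] v(2)[OF j]]) (use t t0 F(2)[OF j] in auto)
    then have "v j \<le> enn2real (rearr a t)"
      using fin[of t] v(1)[of j] by (cases "rearr a t") auto
    then have "v j powr p \<le> enn2real (rearr a t) powr p"
      using p v(1) by (intro powr_mono2) auto
    moreover have "2 powr (real j * (p - 2)) \<le> t powr (p - 2)"
    proof -
      have "2 powr (real j * (p - 2)) = (2^j) powr (p - 2)" by (simp add: powr_powr flip: powr_realpow)
      also have "\<dots> \<le> t powr (p - 2)" using p t t0 by (intro powr_mono2') auto
      finally show ?thesis .
    qed
    ultimately show "ennreal (2 powr (real j * (p - 2)) * v j powr p)
        \<le> ennreal (t powr (p - 2) * enn2real (rearr a t) powr p) * indicator {0<..} t"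
      using t0 by (auto intro!: ennreal_leI mult_mono)
  qed
  also have "\<dots> = lorentz_pow p a" by (rule lorentz_pow_eq[OF p(1) fin, symmetric])
  finally show ?thesis .
qed

section \<open>Pointwise bounds for the dyadic Dirichlet sums\<close>

definition dirichlet_block :: "nat \<Rightarrow> real \<Rightarrow> complex" where
  "dirichlet_block j u = (\<Sum>m=2^j..<2^Suc j. cis (real m * u))"

text \<open>The modulus is 2 sin(|u|/2), and by concavity the sine lies above its chord from 0 to
  pi/2 (Jordan's inequality). The convexity inequality is applied at the point |u|/2, which divides
  that chord in the ratio given by |u|/pi.\<close>

lemma norm_one_minus_cis_ge:
  assumes "\<bar>u\<bar> \<le> pi"
  shows "2 * \<bar>u\<bar> / pi \<le> norm (1 - cis u)"
proof -
  have conv: "convex_on {0..pi} (\<lambda>x. - sin x)"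
    by (rule f''_ge0_imp_convex[where f' = "\<lambda>x. - cos x" and f'' = sin])
       (auto intro!: derivative_eq_intros sin_ge_zero)
  have "\<bar>u\<bar> / pi \<le> sin (\<bar>u\<bar> / 2)"
    using convex_onD[OF conv, of "\<bar>u\<bar> / pi" 0 "pi / 2"] assms by (simp add: field_simps)
  moreover have "(norm (1 - cis u))\<^sup>2 = (2 * sin (\<bar>u\<bar> / 2))\<^sup>2"
  proof -
    have "(norm (1 - cis u))\<^sup>2 = (1 - cos u)\<^sup>2 + (sin u)\<^sup>2" by (simp add: cmod_power2)
    also have "\<dots> = 2 - 2 * cos u" using sin_cos_squared_add[of u] by (simp add: power2_diff algebra_simps)
    also have "cos u = 1 - 2 * (sin (\<bar>u\<bar> / 2))\<^sup>2"
      using cos_double_sin[of "\<bar>u\<bar> / 2"] by simp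
    finally show ?thesis by (simp add: power_mult_distrib)
  qed
  then have "norm (1 - cis u) = \<bar>2 * sin (\<bar>u\<bar> / 2)\<bar>"
    by (metis abs_norm_cancel power2_eq_iff_nonneg abs_ge_zero norm_ge_zero power2_abs)
  ultimately show ?thesis by simp
qed

text \<open>The bound 2^j counts terms. For the other one, multiplication by 1 -
  \<open>cis u\<close> telescopes the block to two unimodular terms.\<close>

lemma norm_dirichlet_block_le:
  assumes "\<bar>u\<bar> \<le> pi" "u \<noteq> 0"
  shows "norm (dirichlet_block j u) \<le> min (2^j) (pi / \<bar>u\<bar>)"
proof (rule min.boundedI)
  show "norm (dirichlet_block j u) \<le> 2^j"
    unfolding dirichlet_block_def by (rule order.trans[OF norm_sum]) simp
  have "(1 - cis u) * dirichlet_block j u = - (\<Sum>m=2^j..<2^Suc j. cis (real (Suc m) * u) - cis (real m * u))"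
    by (simp add: dirichlet_block_def sum_distrib_left algebra_simps cis_mult flip: sum_negf)
  also have "\<dots> = - (cis (real (2^Suc j) * u) - cis (real (2^j) * u))"
    by (subst sum_Suc_diff') auto
  also have "norm \<dots> \<le> 1 + 1"
    unfolding norm_minus_cancel by (rule order.trans[OF norm_triangle_ineq4]) simp
  finally have "norm (1 - cis u) * norm (dirichlet_block j u) \<le> 2" by (simp add: norm_mult)
  moreover have "2 * \<bar>u\<bar> / pi * norm (dirichlet_block j u) \<le> norm (1 - cis u) * norm (dirichlet_block j u)"
    by (intro mult_right_mono norm_one_minus_cis_ge assms) simp
  ultimately have "2 * \<bar>u\<bar> / pi * norm (dirichlet_block j u) \<le> 2" by linarith
  then show "norm (dirichlet_block j u) \<le> pi / \<bar>u\<bar>" using assms by (simp add: field_simps)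
qed

section \<open>Ingredients of the Schur test and the resulting L^p bound\<close>

lemma sum_power_le_max:
  fixes q :: real
  assumes "finite S" "1 < q" "0 \<le> R" "\<And>j. j \<in> S \<Longrightarrow> q^j \<le> R"
  shows "(\<Sum>j\<in>S. q^j) \<le> q / (q - 1) * R"
proof (cases "S = {}")
  case False
  \<comment> \<open>Filling in all exponents up to the largest gives a geometric sum, which is
    within the factor q/(q-1) of its last term.\<close>
  have "(\<Sum>j\<in>S. q^j) \<le> (\<Sum>j<Suc (Max S). q^j)"
    using assms by (intro sum_mono2) (auto simp: less_Suc_eq_le)
  also have "\<dots> = (q^Suc (Max S) - 1) / (q - 1)" using assms by (intro geometric_sum) simp
  also have "\<dots> \<le> q / (q - 1) * q^Max S" using assms by (simp add: field_simps)
  also have "\<dots> \<le> q / (q - 1) * R" using assms False by (intro mult_left_mono) auto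
  finally show ?thesis .
qed (use assms in simp)

text \<open>The counterpart for decaying ratios: filling in the exponents from the smallest one on,
  the first term dominates.\<close>

lemma sum_power_le_min:
  fixes q :: real
  assumes "finite S" "0 < q" "q < 1" "0 \<le> R" "\<And>j. j \<in> S \<Longrightarrow> q^j \<le> R"
  shows "(\<Sum>j\<in>S. q^j) \<le> R / (1 - q)"
proof (cases "S = {}")
  case False
  have "\<not> Max S < Min S" using assms(1) False by (simp only: not_less) simp
  then have gp: "(\<Sum>j=Min S..Max S. q^j) = (q^Min S - q^Suc (Max S)) / (1 - q)"
    using assms(3) by (simp only: sum_gp if_False) simp
  have "(\<Sum>j\<in>S. q^j) \<le> (\<Sum>j=Min S..Max S. q^j)"
    using assms by (intro sum_mono2) auto
  also have "\<dots> = (q^Min S - q^Suc (Max S)) / (1 - q)"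
    by (rule gp)
  also have "\<dots> \<le> q^Min S / (1 - q)" using assms by (intro divide_right_mono) auto
  also have "\<dots> \<le> R / (1 - q)" using assms False by (intro divide_right_mono) auto
  finally show ?thesis .
qed (use assms in simp)

text \<open>First half of the Schur test, the sum over j at fixed v. While 2^j is at most 1/v the
  terms are bounded by a growing geometric sequence of ratio 2^(1-s), afterwards by a decaying one
  of ratio 2^(-s); at the crossover both have size v^(s-1) up to constants.\<close>

lemma sum_dyadic_weights_le:
  fixes s v :: real
  assumes s: "0 < s" "s < 1" and v: "0 < v"
  shows "(\<Sum>j<n. 2 powr (- s * real j) * min (2^j) (pi / v))
     \<le> (2 powr (1 - s) / (2 powr (1 - s) - 1) + pi / (1 - 2 powr (- s))) * v powr (s - 1)"
proof -
  define q where "q = 2 powr (1 - s)"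
  define z where "z = 2 powr (- s)"
  have q: "q > 1" unfolding q_def using s by (simp add: gr_one_powr)
  have z: "0 < z" "z < 1" unfolding z_def using s powr_less_one by auto
  have qj: "q^j = (2^j) powr (1 - s)" for j :: nat
    by (simp add: q_def powr_powr mult.commute flip: powr_realpow)
  have zj: "z^j = (2^j) powr (- s)" for j :: nat
    by (simp add: z_def powr_powr mult.commute flip: powr_realpow)
  have w1: "2 powr (- s * real j) * min (2^j) (pi / v) \<le> q^j" for j
  proof -
    have "2 powr (- s * real j) * min (2^j) (pi / v) \<le> 2 powr (- s * real j) * 2^j"
      by (intro mult_left_mono) auto
    also have "\<dots> = q^j"
      unfolding qj by (simp add: powr_powr algebra_simps flip: powr_realpow powr_add)
    finally show ?thesis .
  qed
  have w2: "2 powr (- s * real j) * min (2^j) (pi / v) \<le> pi / v * z^j" for j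
  proof -
    have "2 powr (- s * real j) * min (2^j) (pi / v) \<le> 2 powr (- s * real j) * (pi / v)"
      by (intro mult_left_mono) auto
    also have "\<dots> = pi / v * z^j"
      unfolding zj by (simp add: powr_powr mult.commute flip: powr_realpow)
    finally show ?thesis .
  qed
  define S1 where "S1 = {j. j < n \<and> 2^j \<le> 1 / v}"
  define S2 where "S2 = {j. j < n \<and> \<not> 2^j \<le> 1 / v}"
  have S: "finite S1" "finite S2" by (simp_all add: S1_def S2_def)
  have "{..<n} = S1 \<union> S2" "S1 \<inter> S2 = {}" by (auto simp: S1_def S2_def)
  then have "(\<Sum>j<n. 2 powr (- s * real j) * min (2^j) (pi / v))
      = (\<Sum>j\<in>S1. 2 powr (- s * real j) * min (2^j) (pi / v)) + (\<Sum>j\<in>S2. 2 powr (- s * real j) * min (2^j) (pi / v))"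
    using S by (simp add: sum.union_disjoint)
  also have "\<dots> \<le> (\<Sum>j\<in>S1. q^j) + (\<Sum>j\<in>S2. pi / v * z^j)"
    by (intro add_mono sum_mono w1 w2)
  also have "(\<Sum>j\<in>S1. q^j) \<le> q / (q - 1) * (1 / v) powr (1 - s)"
    using s v q S by (intro sum_power_le_max) (auto simp: qj S1_def intro!: powr_mono2)
  also have "(\<Sum>j\<in>S2. pi / v * z^j) \<le> pi / v * ((1 / v) powr (- s) / (1 - z))"
    unfolding sum_distrib_left[symmetric]
    using s v z S by (intro mult_left_mono sum_power_le_min) (auto simp: zj S2_def intro!: powr_mono2')
  also have "(1 / v) powr (1 - s) = v powr (s - 1)"
    using v powr_minus_divide[of v "1 - s"] by (simp add: powr_divide)
  also have "pi / v * ((1 / v) powr (- s) / (1 - z)) = pi / (1 - z) * v powr (s - 1)"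
  proof -
    have "(1 / v) powr (- s) / v = v powr (s - 1)"
      using v by (simp add: powr_divide powr_minus powr_diff)
    then show ?thesis by (metis (no_types, lifting) mult.commute times_divide_eq_left times_divide_eq_right)
  qed
  finally show ?thesis by (simp add: q_def z_def distrib_right)
qed

text \<open>Jensen's inequality for x^p with the weights w j / W, then multiplied by W^p. Indices
  with b j = 0 are discarded first, so that Jensen runs over positive arguments only.\<close>

lemma powr_weighted_sum_le:
  fixes b w :: "'a \<Rightarrow> real"
  assumes "finite S" "1 \<le> p" "\<And>j. j \<in> S \<Longrightarrow> 0 < w j" "\<And>j. j \<in> S \<Longrightarrow> 0 \<le> b j"
  shows "(\<Sum>j\<in>S. b j * w j) powr p \<le> (\<Sum>j\<in>S. w j) powr (p - 1) * (\<Sum>j\<in>S. b j powr p * w j)"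
proof -
  define T where "T = {j\<in>S. b j > 0}"
  have T: "finite T" "T \<subseteq> S" using assms by (auto simp: T_def)
  have eq: "(\<Sum>j\<in>S. b j * w j) = (\<Sum>j\<in>T. b j * w j)"
    by (rule sum.mono_neutral_right) (use assms T in \<open>force simp: T_def\<close>)+
  show ?thesis
  proof (cases "T = {}")
    case True
    then show ?thesis using assms by (simp add: eq sum_nonneg less_imp_le)
  next
    case False
    define W where "W = (\<Sum>j\<in>T. w j)"
    have W: "W > 0" unfolding W_def using T False assms by (intro sum_pos) auto
    have "(\<Sum>j\<in>T. (w j / W) *\<^sub>R b j) powr p \<le> (\<Sum>j\<in>T. w j / W * b j powr p)"
      by (rule convex_on_sum[OF T(1) False powr_convex[OF assms(2)]])
         (use W T assms in \<open>auto simp: T_def W_def less_imp_le simp flip: sum_divide_distrib\<close>)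
    also have "(\<Sum>j\<in>T. (w j / W) *\<^sub>R b j) = (\<Sum>j\<in>T. b j * w j) / W"
      by (simp add: sum_divide_distrib mult.commute)
    also have "(\<Sum>j\<in>T. w j / W * b j powr p) = (\<Sum>j\<in>T. b j powr p * w j) / W"
      by (simp add: sum_divide_distrib mult.commute)
    finally have "((\<Sum>j\<in>T. b j * w j) / W) powr p * W powr p \<le> (\<Sum>j\<in>T. b j powr p * w j) / W * W powr p"
      by (intro mult_right_mono) auto
    also have "((\<Sum>j\<in>T. b j * w j) / W) powr p * W powr p = (\<Sum>j\<in>T. b j * w j) powr p"
      using W by (simp add: powr_divide)
    also have "(\<Sum>j\<in>T. b j powr p * w j) / W * W powr p = W powr (p - 1) * (\<Sum>j\<in>T. b j powr p * w j)"
      using W by (simp add: powr_diff)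
    also have "\<dots> \<le> (\<Sum>j\<in>S. w j) powr (p - 1) * (\<Sum>j\<in>S. b j powr p * w j)"
      unfolding W_def using assms T W
      by (intro mult_mono powr_mono2 sum_mono2 sum_nonneg) (auto simp: W_def less_imp_le subset_iff intro!: mult_nonneg_nonneg)
    finally show ?thesis by (simp add: eq)
  qed
qed

lemma nn_integral_abs_shift:
  fixes H :: "real \<Rightarrow> ennreal"
  assumes [measurable]: "H \<in> borel_measurable borel"
  shows "(\<integral>\<^sup>+y. H \<bar>y - c\<bar> \<partial>lborel) = 2 * (\<integral>\<^sup>+v\<in>{0<..}. H v \<partial>lborel)"
proof -
  have "(\<integral>\<^sup>+y. H \<bar>y - c\<bar> \<partial>lborel) = (\<integral>\<^sup>+v. H \<bar>v\<bar> \<partial>lborel)"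
    by (subst nn_integral_real_affine[of _ 1 c]) simp_all
  also have "\<dots> = (\<integral>\<^sup>+v. H v * indicator {0<..} v + H (- v) * indicator {0<..} (- v) \<partial>lborel)"
    by (rule nn_integral_cong_AE)
       (use AE_lborel_singleton[of 0] in \<open>eventually_elim, auto simp: indicator_def abs_if\<close>)
  also have "\<dots> = (\<integral>\<^sup>+v\<in>{0<..}. H v \<partial>lborel) + (\<integral>\<^sup>+v. H (- v) * indicator {0<..} (- v) \<partial>lborel)"
    by (rule nn_integral_add) auto
  also have "(\<integral>\<^sup>+v. H (- v) * indicator {0<..} (- v) \<partial>lborel) = (\<integral>\<^sup>+v\<in>{0<..}. H v \<partial>lborel)"
    by (subst (2) nn_integral_real_affine[of _ "-1" 0]) simp_all
  finally show ?thesis by (simp add: mult_2)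
qed

text \<open>Second half of the Schur test, the integral over v at fixed j. Cutting at v = 2^(-j) and
  bounding the minimum by 2^j below and pi/v above, all powers of 2 cancel, so the bound is uniform
  in j.\<close>

lemma nn_integral_dyadic_weight_le:
  assumes s: "0 < s" "s < 1"
  shows "(\<integral>\<^sup>+v\<in>{0<..}. ennreal (v powr (- s) * (2 powr (- s * real j) * min (2^j) (pi / v))) \<partial>lborel)
     \<le> ennreal (1 / (1 - s) + pi / s)"
proof -
  define a where "a = (1/2::real)^j"
  have a: "a > 0" by (simp add: a_def)
  have ap: "a powr e = 2 powr (- e * real j)" for e
    by (simp add: a_def powr_powr powr_divide powr_minus_divide power_one_over mult.commute flip: powr_realpow)
  have "(\<integral>\<^sup>+v\<in>{0<..}. ennreal (v powr (- s) * (2 powr (- s * real j) * min (2^j) (pi / v))) \<partial>lborel)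
    \<le> (\<integral>\<^sup>+v. ennreal (2 powr ((1 - s) * real j)) * (ennreal (v powr (- s)) * indicator {0<..<a} v)
        + ennreal (2 powr (- s * real j) * pi) * (ennreal (v powr (- s - 1)) * indicator {a..} v) \<partial>lborel)"
  proof (rule nn_integral_mono)
    fix v :: real
    have 1: "v powr (- s) * (2 powr (- s * real j) * min (2^j) (pi / v)) \<le> 2 powr ((1 - s) * real j) * v powr (- s)"
      if "0 < v"
    proof -
      have "2 powr (- s * real j) * min (2^j) (pi / v) \<le> 2 powr (- s * real j) * 2^j"
        by (intro mult_left_mono) auto
      also have "\<dots> = 2 powr ((1 - s) * real j)" by (simp add: algebra_simps flip: powr_realpow powr_add)
      finally show ?thesis by (metis mult.commute mult_left_mono powr_ge_zero)
    qed
    have 2: "v powr (- s) * (2 powr (- s * real j) * min (2^j) (pi / v)) \<le> 2 powr (- s * real j) * pi * v powr (- s - 1)"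
      if "0 < v"
    proof -
      have "2 powr (- s * real j) * min (2^j) (pi / v) \<le> 2 powr (- s * real j) * (pi / v)"
        by (intro mult_left_mono) auto
      then have "v powr (- s) * (2 powr (- s * real j) * min (2^j) (pi / v)) \<le> v powr (- s) * (2 powr (- s * real j) * (pi / v))"
        by (intro mult_left_mono) auto
      also have "\<dots> = 2 powr (- s * real j) * pi * v powr (- s - 1)"
        using that by (simp add: powr_diff)
      finally show ?thesis .
    qed
    show "ennreal (v powr (- s) * (2 powr (- s * real j) * min (2^j) (pi / v))) * indicator {0<..} v
      \<le> ennreal (2 powr ((1 - s) * real j)) * (ennreal (v powr (- s)) * indicator {0<..<a} v)
        + ennreal (2 powr (- s * real j) * pi) * (ennreal (v powr (- s - 1)) * indicator {a..} v)"
      using 1 2 a by (cases "v > 0"; cases "v < a") (auto simp flip: ennreal_mult intro!: ennreal_leI)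
  qed
  also have "\<dots> = ennreal (2 powr ((1 - s) * real j)) * (\<integral>\<^sup>+v\<in>{0<..<a}. ennreal (v powr (- s)) \<partial>lborel)
     + ennreal (2 powr (- s * real j) * pi) * (\<integral>\<^sup>+v\<in>{a..}. ennreal (v powr (- s - 1)) \<partial>lborel)"
    by (simp add: nn_integral_add nn_integral_cmult)
  also have "\<dots> = ennreal (2 powr ((1 - s) * real j) * (a powr (1 - s) / (1 - s)) + 2 powr (- s * real j) * pi * (a powr (- s) / s))"
    using s a by (subst nn_integral_powr_from_0, simp, simp, subst nn_integral_powr_to_inf)
       (auto simp: add.commute simp flip: ennreal_mult ennreal_plus)
  also have "2 powr ((1 - s) * real j) * (a powr (1 - s) / (1 - s)) = 1 / (1 - s)"
    by (simp add: ap flip: powr_add) (simp add: algebra_simps)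
  also have "2 powr (- s * real j) * pi * (a powr (- s) / s) = pi / s"
    by (simp add: ap powr_minus)
  finally show ?thesis .
qed

text \<open>Here s = 1/p'. Schur test for the kernel w j v = 2^(-sj) min(2^j, pi/v): Jensen with
  these weights leaves their total, at most C1 v^(s-1), to the power p - 1. Since (s-1)(p-1) = -s,
  this is a multiple of v^(-s), precisely the weight against which each w j has integral at most
  C2.\<close>

lemma Lp_dirichlet_blocks_le:
  fixes p :: real
  assumes p: "1 < p"
  defines "s \<equiv> 1 - 1/p"
  shows "\<exists>C>0. \<forall>c n. (\<integral>\<^sup>+y\<in>{0..<2*pi}. ennreal (norm (\<Sum>j<n. c j * (2 powr (- s * real j) * dirichlet_block j (y - pi))) powr p) \<partial>lborel)
     \<le> ennreal (C * (\<Sum>j<n. norm (c j) powr p))"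
proof -
  have s: "0 < s" "s < 1" using p by (auto simp: s_def)
  define C1 where "C1 = 2 powr (1 - s) / (2 powr (1 - s) - 1) + pi / (1 - 2 powr (- s))"
  define C2 where "C2 = 1 / (1 - s) + pi / s"
  have "2 powr (1 - s) > 1" "2 powr (- s) < 1" using s by (simp_all add: gr_one_powr powr_less_one)
  then have C1: "C1 > 0" by (auto simp: C1_def intro!: add_pos_pos divide_pos_pos)
  have C2: "C2 > 0" using s by (auto simp: C2_def intro!: add_pos_pos)
  have "(\<integral>\<^sup>+y\<in>{0..<2*pi}. ennreal (norm (\<Sum>j<n. c j * (2 powr (- s * real j) * dirichlet_block j (y - pi))) powr p) \<partial>lborel)
     \<le> ennreal (C1 powr (p - 1) * (2 * C2) * (\<Sum>j<n. norm (c j) powr p))" for c n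
  proof -
    define w where "w j v = 2 powr (- s * real j) * min (2^j) (pi / v)" for j :: nat and v
    define b where "b j = norm (c j)" for j
    have b: "b j \<ge> 0" for j by (simp add: b_def)
    have w: "w j v > 0" if "v > 0" for j v using that by (simp add: w_def)
    \<comment> \<open>The pointwise majorant as a function of the distance to the centre.\<close>
    define H where "H v = (\<Sum>j<n. ennreal (C1 powr (p - 1) * b j powr p) * (ennreal (v powr (- s) * w j v) * indicator {0<..} v))" for v
    have [measurable]: "w j \<in> borel_measurable borel" for j unfolding w_def by measurable
    have [measurable]: "H \<in> borel_measurable borel" unfolding H_def by measurable
    have pt: "ennreal (norm (\<Sum>j<n. c j * (2 powr (- s * real j) * dirichlet_block j u)) powr p) \<le> H \<bar>u\<bar>"
      if u: "\<bar>u\<bar> \<le> pi" "u \<noteq> 0" for u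
    proof -
      have "norm (\<Sum>j<n. c j * (2 powr (- s * real j) * dirichlet_block j u)) \<le> (\<Sum>j<n. b j * w j \<bar>u\<bar>)"
        by (rule order.trans[OF norm_sum])
           (auto simp: norm_mult b_def w_def intro!: sum_mono mult_left_mono norm_dirichlet_block_le[OF u, unfolded min.bounded_iff, THEN conjunct1] norm_dirichlet_block_le[OF u, unfolded min.bounded_iff, THEN conjunct2])
      then have "norm (\<Sum>j<n. c j * (2 powr (- s * real j) * dirichlet_block j u)) powr p \<le> (\<Sum>j<n. b j * w j \<bar>u\<bar>) powr p"
        using p by (intro powr_mono2) auto
      also have "\<dots> \<le> (\<Sum>j<n. w j \<bar>u\<bar>) powr (p - 1) * (\<Sum>j<n. b j powr p * w j \<bar>u\<bar>)"
        using p u by (intro powr_weighted_sum_le w b) auto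
      also have "\<dots> \<le> (C1 * \<bar>u\<bar> powr (s - 1)) powr (p - 1) * (\<Sum>j<n. b j powr p * w j \<bar>u\<bar>)"
        using p u sum_dyadic_weights_le[OF s, of "\<bar>u\<bar>" n] w[of "\<bar>u\<bar>"]
        by (intro mult_right_mono powr_mono2 sum_nonneg) (auto simp: w_def C1_def intro!: sum_nonneg)
      also have "(C1 * \<bar>u\<bar> powr (s - 1)) powr (p - 1) = C1 powr (p - 1) * \<bar>u\<bar> powr (- s)"
      proof -
        have "(s - 1) * (p - 1) = - s" using p by (simp add: s_def field_simps)
        then show ?thesis using C1 by (simp add: powr_mult powr_powr)
      qed
      also have "C1 powr (p - 1) * \<bar>u\<bar> powr (- s) * (\<Sum>j<n. b j powr p * w j \<bar>u\<bar>)
          = (\<Sum>j<n. C1 powr (p - 1) * b j powr p * (\<bar>u\<bar> powr (- s) * w j \<bar>u\<bar>))"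
        by (simp add: sum_distrib_left mult_ac)
      finally have "ennreal (norm (\<Sum>j<n. c j * (2 powr (- s * real j) * dirichlet_block j u)) powr p)
        \<le> ennreal (\<Sum>j<n. C1 powr (p - 1) * b j powr p * (\<bar>u\<bar> powr (- s) * w j \<bar>u\<bar>))"
        by (rule ennreal_leI)
      also have "\<dots> = H \<bar>u\<bar>"
        unfolding H_def using u w[of "\<bar>u\<bar>"] C1
        by (subst sum_ennreal[symmetric]) (auto simp: less_imp_le simp flip: ennreal_mult)
      finally show ?thesis .
    qed
    have "(\<integral>\<^sup>+y\<in>{0..<2*pi}. ennreal (norm (\<Sum>j<n. c j * (2 powr (- s * real j) * dirichlet_block j (y - pi))) powr p) \<partial>lborel)
      \<le> (\<integral>\<^sup>+y. H \<bar>y - pi\<bar> \<partial>lborel)"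
    \<comment> \<open>The centre y = pi has to be excluded, since there the bound pi/|u| has no
      meaning.\<close>
    proof (rule nn_integral_mono_AE)
      show "AE y in lborel. ennreal (norm (\<Sum>j<n. c j * (2 powr (- s * real j) * dirichlet_block j (y - pi))) powr p) * indicator {0..<2*pi} y \<le> H \<bar>y - pi\<bar>"
        using AE_lborel_singleton[of pi]
      proof eventually_elim
        case (elim y)
        then show ?case using pt[of "y - pi"] by (auto simp: indicator_def)
      qed
    qed
    \<comment> \<open>The factor 2 accounts for the two sides of the centre.\<close>
    also have "\<dots> = 2 * (\<integral>\<^sup>+v\<in>{0<..}. H v \<partial>lborel)" by (rule nn_integral_abs_shift) simp
    also have "(\<integral>\<^sup>+v\<in>{0<..}. H v \<partial>lborel) = (\<integral>\<^sup>+v. H v \<partial>lborel)"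
      by (intro nn_integral_cong) (auto simp: H_def indicator_def)
    also have "\<dots> = (\<Sum>j<n. ennreal (C1 powr (p - 1) * b j powr p) * (\<integral>\<^sup>+v\<in>{0<..}. ennreal (v powr (- s) * w j v) \<partial>lborel))"
      unfolding H_def by (subst nn_integral_sum) (simp_all add: nn_integral_cmult)
    also have "\<dots> \<le> (\<Sum>j<n. ennreal (C1 powr (p - 1) * b j powr p) * ennreal C2)"
      unfolding w_def C2_def by (intro sum_mono mult_left_mono nn_integral_dyadic_weight_le s) simp
    also have "\<dots> = ennreal (\<Sum>j<n. C1 powr (p - 1) * b j powr p * C2)"
      using C2 by (subst sum_ennreal[symmetric]) (auto simp flip: ennreal_mult)
    also have "2 * ennreal (\<Sum>j<n. C1 powr (p - 1) * b j powr p * C2)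
        = ennreal (2 * (\<Sum>j<n. C1 powr (p - 1) * b j powr p * C2))"
      using C2 by (subst ennreal_mult) (auto intro!: sum_nonneg)
    also have "2 * (\<Sum>j<n. C1 powr (p - 1) * b j powr p * C2) = C1 powr (p - 1) * (2 * C2) * (\<Sum>j<n. norm (c j) powr p)"
      by (simp add: b_def sum_distrib_left mult_ac)
    finally show ?thesis by (simp add: mult_left_mono)
  qed
  moreover have "C1 powr (p - 1) * (2 * C2) > 0" using C1 C2 by simp
  ultimately show ?thesis by blast
qed

section \<open>Bump functions on the torus and their two-sided estimates\<close>

definition freq_block :: "'n::finite \<Rightarrow> nat \<Rightarrow> (int^'n) set" where
  "freq_block i j = (\<lambda>m. axis i (int m)) ` {2^j..<2^Suc j}"

text \<open>The shift by pi makes x$i - pi range over [-pi, pi), where the Dirichlet bound holds.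
  With s = 1/p' the factor is the normalization that makes the L^p norms uniformly bounded in
  j.\<close>

definition bump :: "real \<Rightarrow> 'n::finite \<Rightarrow> nat \<Rightarrow> real^'n \<Rightarrow> complex" where
  "bump s i j x = 2 powr (- s * real j) * dirichlet_block j (x$i - pi)"

lemma inj_axis_int: "inj_on (\<lambda>m. axis i (int m)) X"
  by (auto simp: inj_on_def axis_eq_axis)

lemma finite_freq_block: "finite (freq_block i j)"
  by (simp add: freq_block_def)

lemma card_freq_block: "card (freq_block i j) = 2^j"
  by (simp add: freq_block_def card_image[OF inj_axis_int])

lemma freq_block_unique:
  assumes "k \<in> freq_block i j" "k \<in> freq_block i j'"
  shows "j = j'"
proof -
  obtain m :: nat where "2^j \<le> m" "m < 2^Suc j" "2^j' \<le> m" "m < 2^Suc j'"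
    using assms by (auto simp: freq_block_def axis_eq_axis)
  then have "(2::nat)^j < 2^Suc j'" "(2::nat)^j' < 2^Suc j" by linarith+
  then have "j < Suc j'" "j' < Suc j" by (meson one_less_numeral_iff power_less_imp_less_exp semiring_norm(76))+
  then show ?thesis by simp
qed

lemma char_axis: "torus_char (axis i (int m)) x = cis (real m * x$i)"
proof -
  have "(\<Sum>l\<in>UNIV. of_int (axis i (int m) $ l) * x$l) = (\<Sum>l\<in>UNIV. if l = i then real m * x$l else 0)"
    by (intro sum.cong) (auto simp: axis_def)
  then show ?thesis by (simp add: torus_char_def)
qed

text \<open>The shift only multiplies the coefficients by unimodular phases, so their moduli stay
  constant on the block.\<close>

lemma bump_trig_poly:
  "bump s i j = (\<lambda>x. \<Sum>k\<in>freq_block i j. (2 powr (- s * real j) * cis (- of_int (k$i) * pi)) * torus_char k x)"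
proof
  fix x
  have "cis (real m * (x$i - pi)) = cis (- real m * pi) * cis (real m * x$i)" for m
    by (simp add: cis_mult algebra_simps)
  then show "bump s i j x = (\<Sum>k\<in>freq_block i j. (2 powr (- s * real j) * cis (- of_int (k$i) * pi)) * torus_char k x)"
    unfolding freq_block_def bump_def dirichlet_block_def
    by (subst sum.reindex[OF inj_axis_int]) (simp add: char_axis sum_distrib_left mult.assoc)
qed

lemma norm_bump_le: "norm (bump s i j x) \<le> 2^j * 2 powr (- s * real j)"
  unfolding bump_trig_poly
  by (rule order.trans[OF trig_poly_bound]) (simp add: norm_mult card_freq_block)

lemma bump_measurable [measurable]: "bump s i j \<in> borel_measurable borel"
  unfolding bump_trig_poly by measurable

lemma integrable_bump: "integrable Tmeas (bump s i j)"
  by (rule integrable_Tmeas_bounded[OF _ norm_bump_le]) (rule borel_imp_Tmeas, simp)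

lemma fourier_bump:
  "fourier (bump s (i::'n::finite) j) k =
     (if k \<in> freq_block i j then (2*pi)^CARD('n) * (2 powr (- s * real j) * cis (- of_int (k$i) * pi)) else 0)"
  unfolding bump_trig_poly by (rule fourier_trig_poly[OF finite_freq_block])

lemma fourier_sum:
  assumes "\<And>j. j \<in> J \<Longrightarrow> integrable Tmeas (f j)"
  shows "fourier (\<lambda>x. \<Sum>j\<in>J. c j * f j x) k = (\<Sum>j\<in>J. c j * fourier (f j) k)"
proof -
  have "fourier (\<lambda>x. \<Sum>j\<in>J. c j * f j x) k = (\<integral>x. (\<Sum>j\<in>J. c j * (f j x * cnj (torus_char k x))) \<partial>Tmeas)"
    unfolding fourier_eq by (simp add: sum_distrib_right mult.assoc)
  also have "\<dots> = (\<Sum>j\<in>J. c j * fourier (f j) k)"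
    using assms by (subst Bochner_Integration.integral_sum) (auto simp: fourier_eq intro!: integrable_mult_right integrable_mult_cnj_char)
  finally show ?thesis .
qed

text \<open>The frequency blocks are disjoint, so only the bump of index j contributes at k.\<close>

lemma norm_fourier_bump_sum:
  fixes i :: "'n::finite"
  assumes "j < n" "k \<in> freq_block i j"
  shows "norm (fourier (\<lambda>x. \<Sum>j<n. c j * bump s i j x) k) = (2*pi)^CARD('n) * 2 powr (- s * real j) * norm (c j)"
proof -
  have "fourier (\<lambda>x. \<Sum>j<n. c j * bump s i j x) k = (\<Sum>j'<n. c j' * fourier (bump s i j') k)"
    by (rule fourier_sum) (rule integrable_bump)
  also have "\<dots> = (\<Sum>j'<n. if j' = j then c j * fourier (bump s i j) k else 0)"
  proof (intro sum.cong refl)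
    show "c j' * fourier (bump s i j') k = (if j' = j then c j * fourier (bump s i j) k else 0)" for j'
      using freq_block_unique[OF assms(2), of j'] by (cases "j' = j") (auto simp: fourier_bump)
  qed
  also have "\<dots> = c j * fourier (bump s i j) k" using assms by simp
  finally show ?thesis using assms by (simp add: fourier_bump norm_mult norm_power)
qed

lemma bump_sum_in_Lp:
  assumes "0 < p"
  shows "in_Lp p (\<lambda>x. \<Sum>j<n. c j * bump s i j x)"
  unfolding in_Lp_def
proof
  have [measurable]: "bump s i j \<in> borel_measurable Tmeas" for j by (rule borel_imp_Tmeas) simp
  show [measurable]: "(\<lambda>x. \<Sum>j<n. c j * bump s i j x) \<in> borel_measurable Tmeas" by measurable
  define B where "B j = 2^j * 2 powr (- s * real j)" for j
  have "norm (\<Sum>j<n. c j * bump s i j x) \<le> (\<Sum>j<n. norm (c j) * B j)" for x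
    by (rule order.trans[OF norm_sum])
       (unfold norm_mult B_def, intro sum_mono mult_left_mono norm_bump_le norm_ge_zero)
  then have "norm (norm (\<Sum>j<n. c j * bump s i j x) powr p) \<le> (\<Sum>j<n. norm (c j) * B j) powr p" for x
    using assms by (auto intro!: powr_mono2)
  then show "integrable Tmeas (\<lambda>x. norm (\<Sum>j<n. c j * bump s i j x) powr p)"
    by (rule integrable_Tmeas_bounded[rotated]) simp
qed

lemma bump_sums_independent:
  assumes "AE x in Tmeas. (\<Sum>j<n. c j * bump s i j x) = 0" "j < n"
  shows "c j = 0"
proof -
  \<comment> \<open>The lowest frequency of block j; the coefficient there has modulus a nonzero
    multiple of |c j|.\<close>
  let ?k = "axis i (int (2^j))"
  have "fourier (\<lambda>x. \<Sum>j<n. c j * bump s i j x) ?k = 0"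
    unfolding fourier_eq by (rule integral_eq_zero_AE) (use assms(1) in \<open>auto elim: eventually_mono\<close>)
  moreover have "?k \<in> freq_block i j" unfolding freq_block_def by (rule imageI) simp
  ultimately show ?thesis using norm_fourier_bump_sum[OF assms(2), of ?k i c s] by simp
qed

lemma bump_sums_Lp_le:
  fixes i :: "'n::finite" and p :: real
  assumes p: "1 < p"
  defines "s \<equiv> 1 - 1/p"
  shows "\<exists>K>0. \<forall>c n. (\<integral>x. norm (\<Sum>j<n. c j * bump s i j x) powr p \<partial>Tmeas) \<le> K * (\<Sum>j<n. norm (c j) powr p)"
proof -
  obtain C where C: "C > 0" "\<And>c n. (\<integral>\<^sup>+y\<in>{0..<2*pi}. ennreal (norm (\<Sum>j<n. c j * (2 powr (- s * real j) * dirichlet_block j (y - pi))) powr p) \<partial>lborel)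
     \<le> ennreal (C * (\<Sum>j<n. norm (c j) powr p))"
    using Lp_dirichlet_blocks_le[OF p, folded s_def] by blast
  \<comment> \<open>The mass of the remaining coordinates, on which the bumps do not depend.\<close>
  define D where "D = (2*pi)^(CARD('n)-1)"
  have D: "D > 0" by (simp add: D_def)
  have "(\<integral>x. norm (\<Sum>j<n. c j * bump s i j x) powr p \<partial>Tmeas) \<le> D * C * (\<Sum>j<n. norm (c j) powr p)" for c n
  proof -
    define g where "g y = ennreal (norm (\<Sum>j<n. c j * (2 powr (- s * real j) * dirichlet_block j (y - pi))) powr p)" for y
    have "(\<lambda>y. dirichlet_block j (y - pi)) \<in> borel_measurable borel" for j
      unfolding dirichlet_block_def by (intro borel_measurable_continuous_onI continuous_intros)
    then have [measurable]: "g \<in> borel_measurable borel" unfolding g_def by measurable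
    have "ennreal (\<integral>x. norm (\<Sum>j<n. c j * bump s i j x) powr p \<partial>Tmeas)
        = (\<integral>\<^sup>+x. ennreal (norm (\<Sum>j<n. c j * bump s i j x) powr p) \<partial>Tmeas)"
      using bump_sum_in_Lp[of p c s i n] p by (intro nn_integral_eq_integral[symmetric]) (auto simp: in_Lp_def)
    also have "\<dots> = (\<integral>\<^sup>+x. g (x$i) \<partial>Tmeas)"
      by (simp add: g_def bump_def)
    also have "\<dots> = ennreal D * (\<integral>\<^sup>+y\<in>{0..<2*pi}. g y \<partial>lborel)"
      unfolding D_def by (rule nn_integral_torus_coordinate) simp
    also have "\<dots> \<le> ennreal D * ennreal (C * (\<Sum>j<n. norm (c j) powr p))"
      unfolding g_def by (intro mult_left_mono C) simp
    also have "\<dots> = ennreal (D * C * (\<Sum>j<n. norm (c j) powr p))"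
      using C D by (simp add: sum_nonneg mult.assoc flip: ennreal_mult)
    finally show ?thesis using C D by (simp add: ennreal_le_iff sum_nonneg)
  qed
  moreover have "D * C > 0" using C D by simp
  ultimately show ?thesis by blast
qed

lemma bump_sums_lorentz_ge:
  fixes i :: "'n::finite"
  assumes p: "1 < p" "p < 2"
  defines "s \<equiv> 1 - 1/p"
  shows "ennreal (((2*pi)^CARD('n)) powr p / 2 * (\<Sum>j<n. norm (c j) powr p))
    \<le> lorentz_pow p (fourier (\<lambda>x. \<Sum>j<n. c j * bump s i j x))"
proof -
  define a where "a = fourier (\<lambda>x. \<Sum>j<n. c j * bump s i j x)"
  define A where "A = (2*pi)^CARD('n)"
  have A: "A > 0" by (simp add: A_def)
  define v where "v j = A * 2 powr (- s * real j) * norm (c j)" for j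
  have fin: "rearr a t < top" for t
    unfolding a_def using rearr_bounded[OF norm_fourier_le] by (rule le_less_trans) simp_all
  \<comment> \<open>This identity makes the normalization 2^(-sj), raised to the power p, cancel the
    factor 2^(j(p-1)) of the dyadic lower bound.\<close>
  have sp: "s * p = p - 1" using p by (simp add: s_def field_simps)
  have v_powr: "v j powr p * 2 powr (real j * (p - 1)) / 2 = A powr p / 2 * norm (c j) powr p" for j
  proof -
    have "v j powr p = A powr p * 2 powr (- (real j * (p - 1))) * norm (c j) powr p"
      using A by (simp add: v_def powr_mult powr_powr sp[symmetric] mult_ac)
    then show ?thesis by (simp add: powr_minus)
  qed
  have "ennreal (A powr p / 2 * (\<Sum>j<n. norm (c j) powr p)) = ennreal (\<Sum>j<n. v j powr p * 2 powr (real j * (p - 1)) / 2)"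
    unfolding v_powr by (simp add: sum_distrib_left)
  also have "\<dots> \<le> lorentz_pow p a"
    by (rule lorentz_pow_ge_dyadic[OF p fin, of n "freq_block i"])
       (use A norm_fourier_bump_sum[of _ n _ i c s] in \<open>auto simp: finite_freq_block card_freq_block v_def a_def A_def\<close>)
  finally show ?thesis by (simp add: A_def a_def)
qed

section \<open>The span of the bumps and the conclusion\<close>

lemma fun_subspace_finite_sums:
  fixes F :: "nat \<Rightarrow> 'a \<Rightarrow> complex"
  shows "fun_subspace {(\<lambda>x. \<Sum>j<n. c j * F j x) | c n. True}"
  unfolding fun_subspace_def
proof (intro conjI ballI allI)
  show "(\<lambda>x. 0) \<in> {(\<lambda>x. \<Sum>j<n. c j * F j x) | c n. True}"
    by (auto intro!: exI[of _ "\<lambda>_. 0"])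
  fix f g and a :: complex
  assume "f \<in> {(\<lambda>x. \<Sum>j<n. c j * F j x) | c n. True}" "g \<in> {(\<lambda>x. \<Sum>j<n. c j * F j x) | c n. True}"
  then obtain c n d m where f: "f = (\<lambda>x. \<Sum>j<n. c j * F j x)" and g: "g = (\<lambda>x. \<Sum>j<m. d j * F j x)"
    by blast
  define N where "N = max n m"
  have N: "n \<le> N" "m \<le> N" by (simp_all add: N_def)
  \<comment> \<open>Sums of different lengths are padded with zero coefficients to the common length
    N.\<close>
  define e where "e j = a * (if j < n then c j else 0) + (if j < m then d j else 0)" for j
  have trunc: "(\<Sum>j<N. (if j < n' then c' j else 0) * F j x) = (\<Sum>j<n'. c' j * F j x)" if "n' \<le> N" for n' c' x
    using that by (intro sum.mono_neutral_cong_right) auto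
  have "(\<lambda>x. a * f x + g x) = (\<lambda>x. \<Sum>j<N. e j * F j x)"
  proof
    fix x
    have "(\<Sum>j<N. e j * F j x) = a * (\<Sum>j<N. (if j < n then c j else 0) * F j x) + (\<Sum>j<N. (if j < m then d j else 0) * F j x)"
      by (simp only: e_def distrib_right sum.distrib sum_distrib_left mult.assoc)
    then show "a * f x + g x = (\<Sum>j<N. e j * F j x)"
      by (simp only: f g trunc[OF N(1)] trunc[OF N(2)])
  qed
  then show "(\<lambda>x. a * f x + g x) \<in> {(\<lambda>x. \<Sum>j<n. c j * F j x) | c n. True}"
    by (intro CollectI exI[of _ e] exI[of _ N] conjI TrueI)
qed

theorem theorem5p6:
  fixes p :: real
  assumes "1 < p" and "p < 2"
  shows "(\<forall>f g c. in_Lp p f \<longrightarrow> in_Lp p g \<longrightarrow>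
            fourier (\<lambda>x::real^'n. c * f x + g x) = (\<lambda>k. c * fourier f k + fourier g k))
       \<and> (\<exists>C. \<forall>f::real^'n \<Rightarrow> complex. in_Lp p f \<longrightarrow>
            in_lorentz p (fourier f) \<and> lorentz_norm p (fourier f) \<le> C * Lp_norm p f)
       \<and> (\<exists>Z::(real^'n \<Rightarrow> complex) set. (\<forall>f\<in>Z. in_Lp p f) \<and> fun_subspace Z \<and>
            inf_dim_ae Tmeas Z \<and>
            (\<exists>c>0. \<forall>f\<in>Z. c * Lp_norm p f \<le> lorentz_norm p (fourier f)))"
proof (intro conjI)
  define s where "s = 1 - 1/p"
  have p: "1 < p" "p < 2" by fact+
  show "\<forall>f g c. in_Lp p f \<longrightarrow> in_Lp p g \<longrightarrow>
            fourier (\<lambda>x::real^'n. c * f x + g x) = (\<lambda>k. c * fourier f k + fourier g k)"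
    using in_Lp_imp_integrable[of p] p by (auto intro!: ext fourier_linear)
  define C where "C = 2 * p / (p - 1) + 4 * (2*pi)^CARD('n) * p / (2 - p)"
  have C: "C \<ge> 0" using p by (simp add: C_def)
  have paley: "lorentz_pow p (fourier f) \<le> ennreal (C * (\<integral>x. norm (f x) powr p \<partial>Tmeas))"
    if "in_Lp p f" for f :: "real^'n \<Rightarrow> complex"
    using paley_inequality[OF p that] C unfolding C_def[symmetric] by (simp add: ennreal_mult)
  have bdd: "in_lorentz p (fourier f)" if "in_Lp p f" for f :: "real^'n \<Rightarrow> complex"
    unfolding in_lorentz_def using paley[OF that] by (rule le_less_trans) simp
  have "lorentz_norm p (fourier f) \<le> C powr (1/p) * Lp_norm p f" if "in_Lp p f" for f :: "real^'n \<Rightarrow> complex"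
  proof -
    have "enn2real (lorentz_pow p (fourier f)) \<le> C * (\<integral>x. norm (f x) powr p \<partial>Tmeas)"
      using C by (intro enn2real_leI paley that) auto
    then have "lorentz_norm p (fourier f) \<le> (C * (\<integral>x. norm (f x) powr p \<partial>Tmeas)) powr (1/p)"
      unfolding lorentz_norm_def using p by (intro powr_mono2) auto
    then show ?thesis using C by (simp add: Lp_norm_def powr_mult)
  qed
  with bdd show "\<exists>C. \<forall>f::real^'n \<Rightarrow> complex. in_Lp p f \<longrightarrow>
            in_lorentz p (fourier f) \<and> lorentz_norm p (fourier f) \<le> C * Lp_norm p f"
    by blast
  \<comment> \<open>An arbitrary coordinate axis, which carries all frequencies used.\<close>
  obtain i :: 'n where True by blast
  \<comment> \<open>The algebraic span of the bumps. On it the p-th powers of both norms are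
    comparable to the sum of |c j|^p, so the transform is bounded below.\<close>
  define Z where "Z = {(\<lambda>x. \<Sum>j<n. c j * bump s i j x) | c n. True}"
  have Z_Lp: "\<forall>f\<in>Z. in_Lp p f" using p by (auto simp: Z_def intro!: bump_sum_in_Lp)
  have bump_Z: "bump s i j \<in> Z" for j
    unfolding Z_def by (rule CollectI, rule exI[of _ "\<lambda>l. if l = j then 1 else 0"], rule exI[of _ "Suc j"])
      (auto simp: if_distrib[of "\<lambda>z. z * _"] cong: if_cong)
  have "inf_dim_ae Tmeas Z"
    unfolding inf_dim_ae_def
    by (intro allI exI[of _ "bump s i"] conjI impI bump_Z) (rule bump_sums_independent)
  moreover have "\<exists>c>0. \<forall>f\<in>Z. c * Lp_norm p f \<le> lorentz_norm p (fourier f)"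
  proof -
    obtain K where K: "K > 0"
      "\<And>c n. (\<integral>x. norm (\<Sum>j<n. c j * bump s i j x) powr p \<partial>Tmeas) \<le> K * (\<Sum>j<n. norm (c j) powr p)"
      using bump_sums_Lp_le[OF p(1), of i, folded s_def] by blast
    define B where "B = ((2*pi)^CARD('n)) powr p / 2"
    have B: "B > 0" by (simp add: B_def)
    have "(B / K) powr (1/p) * Lp_norm p f \<le> lorentz_norm p (fourier f)" if f_Z: "f \<in> Z" for f
    proof -
      obtain c n where f: "f = (\<lambda>x. \<Sum>j<n. c j * bump s i j x)" using f_Z by (auto simp: Z_def)
      define X where "X = (\<Sum>j<n. norm (c j) powr p)"
      have X: "X \<ge> 0" by (simp add: X_def sum_nonneg)
      \<comment> \<open>Finiteness, supplied by Paley's inequality, is essential here: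
        \<open>enn2real\<close> sends infinity to 0, which would destroy the lower bound.\<close>
      have "lorentz_pow p (fourier f) < top" using bdd Z_Lp f_Z by (auto simp: in_lorentz_def)
      moreover have "ennreal (B * X) \<le> lorentz_pow p (fourier f)"
        unfolding f B_def X_def s_def by (rule bump_sums_lorentz_ge[OF p])
      ultimately have lower: "B * X \<le> enn2real (lorentz_pow p (fourier f))"
        using B X by (cases "lorentz_pow p (fourier f)") auto
      \<comment> \<open>Eliminating X between the upper L^p bound K X and the lower Lorentz bound B
        X yields the constant (B/K)^(1/p).\<close>
      have "B / K * (\<integral>x. norm (f x) powr p \<partial>Tmeas) \<le> B / K * (K * X)"
        using K(2)[of c n] K(1) B by (intro mult_left_mono) (auto simp: f X_def)
      also have "\<dots> = B * X" using K by simp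
      also note lower
      finally have "(B / K * (\<integral>x. norm (f x) powr p \<partial>Tmeas)) powr (1/p) \<le> lorentz_norm p (fourier f)"
        unfolding lorentz_norm_def using p B K by (intro powr_mono2) auto
      then show ?thesis unfolding Lp_norm_def powr_mult .
    qed
    moreover have "(B / K) powr (1/p) > 0" using B K by simp
    ultimately show ?thesis by blast
  qed
  moreover have "fun_subspace Z" unfolding Z_def by (rule fun_subspace_finite_sums)
  ultimately show "\<exists>Z::(real^'n \<Rightarrow> complex) set. (\<forall>f\<in>Z. in_Lp p f) \<and> fun_subspace Z \<and>
            inf_dim_ae Tmeas Z \<and> (\<exists>c>0. \<forall>f\<in>Z. c * Lp_norm p f \<le> lorentz_norm p (fourier f))"
    using Z_Lp by blast
qed

end
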